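(* For every $\gamma\in[0,1]$, $$\mathfrak D_{s,\lambda,\gamma}(P,Q)=\sup_{u\in\mathcal U_{s,\lambda,\gamma}}\left\{\int_D u\,dP-\int_D u\,dQ\right\}.$$ Consequently, $P\preceq_{s,\lambda,\gamma}^{\rm CSD}Q$ if and only if $\int_D u\,dP\le\int_D u\,dQ$ for every $u\in\mathcal U_{s,\lambda,\gamma}$.
   Context: Let $D\subseteq\mathbb R^d$ be a nonempty Borel set; $P,Q$ are Borel probability measures supported on $D$ (i.e. $P(D)=Q(D)=1$) with finite first moments. $\mathcal C(P,Q)$ is the set of couplings of $P$ and $Q$ (first marginal $P$, second marginal $Q$), and $t_+:=\max\{t,0\}$. Let $(\Theta,\mathscr A,\lambda)$ be a finite measure space and $s:\Theta\times\mathbb R^d\to\mathbb R$ jointly measurable; write $s_\theta(x):=s(\theta,x)$. Standing assumptions: each $s_\theta$ is coordinatewise nondecreasing, $\int_\Theta|s_\theta(0)|\,\lambda(d\theta)<\infty$, and for some finite constant $\overline L_s$, $\int_\Theta|s_\theta(x)-s_\theta(y)|\,\lambda(d\theta)\le\overline L_s\|x-y\|_1$ for all $x,y\in\mathbb R^d$. Define $\ell_s(x,y):=\int_\Theta(s_\theta(x)-s_\theta(y))_+\,\lambda(d\theta)$, $$\mathfrak D_{s,\lambda,\gamma}(P,Q):=\inf_{\kappa\in\mathcal C(P,Q)}\int_{D\times D}\{\ell_s(x,y)-\gamma\,\ell_s(y,x)\}\,\kappa(dx,dy),$$ $$\mathcal U_{s,\lambda,\gamma}:=\{u:\mathbb R^d\to\mathbb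 R:\ u(x)-u(y)\le\ell_s(x,y)-\gamma\,\ell_s(y,x)\text{ for all }x,y\in\mathbb R^d\}.$$ (Every such $u$ is continuous and integrable under $P$ and $Q$.) Compensated stochastic dominance (CSD): $P\preceq_{s,\lambda,\gamma}^{\rm CSD}Q$ means that there exists $\kappa\in\mathcal C(P,Q)$ with $\int_{D\times D}\ell_s(x,y)\,\kappa(dx,dy)\le\gamma\int_{D\times D}\ell_s(y,x)\,\kappa(dx,dy)$. *)

theory Defs
  imports "HOL-Probability.Probability"
begin

definition l1_norm :: "real ^ 'd \<Rightarrow> real" where
  "l1_norm x = (\<Sum>i\<in>UNIV. \<bar>x $ i\<bar>)"

definition couplings ::
  "(real ^ 'd) measure \<Rightarrow> (real ^ 'd) measure \<Rightarrow> ((real ^ 'd) \<times> (real ^ 'd)) measure set" where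
  "couplings P Q = {\<kappa>. prob_space \<kappa> \<and> sets \<kappa> = sets (borel \<Otimes>\<^sub>M borel) \<and>
     distr \<kappa> borel fst = P \<and> distr \<kappa> borel snd = Q}"

definition ell :: "'t measure \<Rightarrow> ('t \<Rightarrow> real ^ 'd \<Rightarrow> real) \<Rightarrow> real ^ 'd \<Rightarrow> real ^ 'd \<Rightarrow> real" where
  "ell \<Lambda> s x y = (\<integral>\<theta>. max (s \<theta> x - s \<theta> y) 0 \<partial>\<Lambda>)"

text \<open>The infimum is taken in the extended reals, so that it is meaningful
  without prior knowledge of boundedness.\<close>

definition csd_div ::
  "'t measure \<Rightarrow> ('t \<Rightarrow> real ^ 'd \<Rightarrow> real) \<Rightarrow> real \<Rightarrow> (real ^ 'd) set
    \<Rightarrow> (real ^ 'd) measure \<Rightarrow> (real ^ 'd) measure \<Rightarrow> ereal" where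
  "csd_div \<Lambda> s \<gamma> D P Q = (INF \<kappa>\<in>couplings P Q.
     ereal (LINT z:D \<times> D|\<kappa>. ell \<Lambda> s (fst z) (snd z) - \<gamma> * ell \<Lambda> s (snd z) (fst z)))"

definition csd_utilities ::
  "'t measure \<Rightarrow> ('t \<Rightarrow> real ^ 'd \<Rightarrow> real) \<Rightarrow> real \<Rightarrow> (real ^ 'd \<Rightarrow> real) set" where
  "csd_utilities \<Lambda> s \<gamma> = {u. \<forall>x y. u x - u y \<le> ell \<Lambda> s x y - \<gamma> * ell \<Lambda> s y x}"

definition csd_le ::
  "'t measure \<Rightarrow> ('t \<Rightarrow> real ^ 'd \<Rightarrow> real) \<Rightarrow> real \<Rightarrow> (real ^ 'd) set
    \<Rightarrow> (real ^ 'd) measure \<Rightarrow> (real ^ 'd) measure \<Rightarrow> bool" where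
  "csd_le \<Lambda> s \<gamma> D P Q \<longleftrightarrow> (\<exists>\<kappa>\<in>couplings P Q.
     (LINT z:D \<times> D|\<kappa>. ell \<Lambda> s (fst z) (snd z))
       \<le> \<gamma> * (LINT z:D \<times> D|\<kappa>. ell \<Lambda> s (snd z) (fst z)))"

end

theory Submission
  imports Defs
begin

text \<open>
  Since \<open>\<gamma> \<le> 1\<close>, the cost \<open>c(x,y) = \<ell>(x,y) - \<gamma> \<ell>(y,x)\<close> satisfies the triangle inequality, and it is bounded by a
  multiple of the distance; so the claim is Kantorovich--Rubinstein duality with an attained minimum.
  Quantise both marginals by a simple function \<open>F\<close> close to the identity. An optimal plan of the resulting finite
  problem cannot be improved along cycles, which yields a potential \<open>u\<close> on the whole space with
  \<open>u(x) - u(y) \<le> c(x,y)\<close> and equality on the support of the plan; spreading the plan over the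
  cells of \<open>F\<close> by a density with respect to \<open>P \<otimes> Q\<close> gives a coupling of \<open>P\<close> and \<open>Q\<close>
  whose cost exceeds the dual value by a multiple of the quantisation error only.
  For attainment, take simple \<open>F\<^sub>i\<close> converging to the identity. Along a subsequence of
  couplings the laws of all finite tuples of \<open>(F\<^sub>i x, F\<^sub>i y)\<close> converge; Kolmogorov's extension theorem
  turns their limits into a measure on sequences, and the law of the limit of the sequence is a coupling of
  \<open>P\<close> and \<open>Q\<close>, because the law of each coordinate sequence is that of \<open>(F\<^sub>i x)\<^sub>i\<close>
  under the fixed marginal.
\<close>

section \<open>Finite transport problems\<close>

text \<open>Rockafellar's construction: a chain \<open>x\<^sub>0, y\<^sub>0, x\<^sub>1, y\<^sub>1, \<dots>\<close> with \<open>(x\<^sub>k, y\<^sub>k) \<in> S\<close>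
  carries the weight \<open>r = \<Sum>\<^sub>k c(x\<^sub>k\<^sub>+\<^sub>1, y\<^sub>k) - c(x\<^sub>k, y\<^sub>k)\<close>, and closed chains have
  nonnegative weight iff \<open>S\<close> is \<open>c\<close>-cyclically monotone.\<close>

inductive alt_chain :: "('a \<Rightarrow> 'a \<Rightarrow> real) \<Rightarrow> ('a \<times> 'a) set \<Rightarrow> 'a set \<Rightarrow> 'a \<Rightarrow> 'a \<Rightarrow> real \<Rightarrow> bool"
  for c S R x0 where
  start: "alt_chain c S R x0 x0 0"
| step: "alt_chain c S R x0 x r \<Longrightarrow> (x, y) \<in> S \<Longrightarrow> x' \<in> R
    \<Longrightarrow> alt_chain c S R x0 x' (r + c x' y - c x y)"

text \<open>\<open>u x\<close> is the infimum of the weights of chains that start at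
  \<open>x0\<close>, run through \<open>S\<close> and end at \<open>x\<close>, where the last point
  may lie outside \<open>R\<close>. Closing such a chain at \<open>x0\<close> instead and using the
  triangle inequality bounds its weight below by \<open>- c x0 x\<close>. The triangle inequality
  also lets this one function serve as potential for both marginals.\<close>

lemma tight_potential:
  fixes c :: "'a \<Rightarrow> 'a \<Rightarrow> real"
  assumes tri: "\<And>x y z. c x z \<le> c x y + c y z" and diag: "\<And>x. c x x = 0"
    and S: "S \<subseteq> R \<times> R" and x0: "(x0, y0) \<in> S"
    and closed: "\<And>r. alt_chain c S R x0 x0 r \<Longrightarrow> 0 \<le> r"
  obtains u where "\<And>x y. u x - u y \<le> c x y" "\<And>x y. (x, y) \<in> S \<Longrightarrow> u x - u y = c x y"
proof -
  define W where "W x = {r + c x y - c x' y |r x' y. alt_chain c S R x0 x' r \<and> (x', y) \<in> S}" for x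
  define u where "u x = Inf (W x)" for x
  have ne: "W x \<noteq> {}" for x
    using x0 alt_chain.start[of c S R x0] unfolding W_def by blast
  have lower: "- c x0 x \<le> w" if "w \<in> W x" for w x
  proof -
    from that obtain r x' y where w: "w = r + c x y - c x' y" "alt_chain c S R x0 x' r" "(x', y) \<in> S"
      unfolding W_def by blast
    have "alt_chain c S R x0 x0 (r + c x0 y - c x' y)"
      using w x0 S by (intro alt_chain.step) auto
    from closed[OF this] tri[of x0 y x] show ?thesis unfolding w(1) by linarith
  qed
  have bdd: "bdd_below (W x)" for x
    using lower by (auto simp: bdd_below_def)
  have u_le: "u x - u z \<le> c x z" for x z
  proof -
    have "u x - c x z \<le> w" if "w \<in> W z" for w
    proof -
      from that obtain r x' y where w: "w = r + c z y - c x' y" "alt_chain c S R x0 x' r" "(x', y) \<in> S"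
        unfolding W_def by blast
      have "u x \<le> r + c x y - c x' y"
        unfolding u_def using w by (intro cInf_lower bdd) (auto simp: W_def)
      with tri[of x y z] show ?thesis unfolding w(1) by linarith
    qed
    then have "u x - c x z \<le> u z" unfolding u_def[of z] by (intro cInf_greatest ne)
    then show ?thesis by simp
  qed
  have "u a - u b = c a b" if ab: "(a, b) \<in> S" for a b
  proof -
    \<comment> \<open>Since \<open>a\<close> lies in \<open>R\<close>, \<open>w\<close> is itself a
      chain weight at \<open>a\<close>; appending the pair \<open>(a, b)\<close> and ending at
      \<open>b\<close> adds \<open>c b b - c a b = - c a b\<close>.\<close>
    have "u b + c a b \<le> w" if "w \<in> W a" for w
    proof -
      have "alt_chain c S R x0 a w"
        using that ab S unfolding W_def by (auto intro: alt_chain.step)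
      then have "w + c b b - c a b \<in> W b" unfolding W_def using ab by blast
      then have "u b \<le> w + c b b - c a b" unfolding u_def by (intro cInf_lower bdd)
      then show ?thesis by (simp add: diag)
    qed
    then have "u b + c a b \<le> u a" unfolding u_def[of a] by (intro cInf_greatest ne)
    with u_le[of a b] show ?thesis by simp
  qed
  with u_le show ?thesis by (rule that)
qed

text \<open>Plans are functions on all pairs; prescribing the value 0 off
  \<open>R \<times> R\<close> makes the set of plans compact in the product topology.\<close>

definition plans :: "'a set \<Rightarrow> ('a \<Rightarrow> real) \<Rightarrow> ('a \<Rightarrow> real) \<Rightarrow> ('a \<times> 'a \<Rightarrow> real) set" where
  "plans R p q = {\<pi>. (\<forall>z. 0 \<le> \<pi> z) \<and> (\<forall>z. z \<notin> R \<times> R \<longrightarrow> \<pi> z = 0) \<and>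
     (\<forall>i\<in>R. (\<Sum>j\<in>R. \<pi> (i, j)) = p i) \<and> (\<forall>j\<in>R. (\<Sum>i\<in>R. \<pi> (i, j)) = q j)}"

text \<open>Each step of a chain moves a unit of mass from \<open>(x, y) \<in> S\<close> to
  \<open>(x', y)\<close>. Column sums stay fixed, row sums telescope to the two ends, and the cost
  changes by the weight of the step. A closed chain thus yields a direction that keeps both
  marginals and can be negative only on \<open>S\<close>.\<close>

lemma alt_chain_perturbation:
  fixes c :: "'a \<Rightarrow> 'a \<Rightarrow> real"
  assumes "alt_chain c S R x0 x r" and R: "finite R" and S: "S \<subseteq> R \<times> R" and x0: "x0 \<in> R"
  shows "x \<in> R \<and> (\<exists>d. (\<forall>z. z \<notin> R \<times> R \<longrightarrow> d z = 0) \<and> (\<forall>z. z \<notin> S \<longrightarrow> 0 \<le> d z) \<and>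
    (\<forall>i\<in>R. (\<Sum>j\<in>R. d (i, j)) = of_bool (i = x) - of_bool (i = x0)) \<and>
    (\<forall>j\<in>R. (\<Sum>i\<in>R. d (i, j)) = 0) \<and>
    (\<Sum>z\<in>R\<times>R. d z * c (fst z) (snd z)) = r)"
  using assms(1)
proof induction
  case start
  then show ?case using x0 by (intro conjI exI[of _ "\<lambda>_. 0"]) auto
next
  case (step x r y x')
  then obtain d where d: "\<And>z. z \<notin> R \<times> R \<Longrightarrow> d z = 0" "\<And>z. z \<notin> S \<Longrightarrow> 0 \<le> d z"
    "\<And>i. i \<in> R \<Longrightarrow> (\<Sum>j\<in>R. d (i, j)) = of_bool (i = x) - of_bool (i = x0)"
    "\<And>j. j \<in> R \<Longrightarrow> (\<Sum>i\<in>R. d (i, j)) = 0"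
    "(\<Sum>z\<in>R\<times>R. d z * c (fst z) (snd z)) = r" and x: "x \<in> R" by blast
  have y: "y \<in> R" using step S by auto
  define e :: "'a \<times> 'a \<Rightarrow> real" where "e z = d z + of_bool (z = (x', y)) - of_bool (z = (x, y))" for z
  have "(\<Sum>j\<in>R. e (i, j)) = of_bool (i = x') - of_bool (i = x0)" if i: "i \<in> R" for i
  proof -
    have "(\<Sum>j\<in>R. e (i, j)) = (\<Sum>j\<in>R. d (i, j)) + (\<Sum>j\<in>R. if j = y then of_bool (i = x') - of_bool (i = x) else 0)"
      unfolding e_def sum.distrib[symmetric] by (intro sum.cong) auto
    also have "\<dots> = of_bool (i = x') - of_bool (i = x0)"
      using y R by (simp add: d(3)[OF i])
    finally show ?thesis .
  qed
  moreover have "(\<Sum>i\<in>R. e (i, j)) = 0" if j: "j \<in> R" for j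
  proof -
    have "(\<Sum>i\<in>R. e (i, j)) = (\<Sum>i\<in>R. d (i, j)) + (\<Sum>i\<in>R. if i = x' then of_bool (j = y) else 0)
        - (\<Sum>i\<in>R. if i = x then of_bool (j = y) else 0)"
      unfolding e_def sum.distrib[symmetric] sum_subtractf[symmetric] by (intro sum.cong) auto
    also have "\<dots> = 0" using x step R by (simp add: d(4)[OF j])
    finally show ?thesis .
  qed
  moreover have "(\<Sum>z\<in>R\<times>R. e z * c (fst z) (snd z)) = r + c x' y - c x y"
  proof -
    have "(\<Sum>z\<in>R\<times>R. e z * c (fst z) (snd z)) = (\<Sum>z\<in>R\<times>R. d z * c (fst z) (snd z))
        + (\<Sum>z\<in>R\<times>R. if z = (x', y) then c x' y else 0) - (\<Sum>z\<in>R\<times>R. if z = (x, y) then c x y else 0)"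
      unfolding e_def sum.distrib[symmetric] sum_subtractf[symmetric]
      by (intro sum.cong) (auto simp: algebra_simps)
    also have "\<dots> = r + c x' y - c x y"
      using x y step R by (simp add: d(5))
    finally show ?thesis .
  qed
  moreover have "e z = 0" if "z \<notin> R \<times> R" for z
    using that d(1)[OF that] x y step by (auto simp: e_def)
  moreover have "0 \<le> e z" if "z \<notin> S" for z
    using that d(2)[OF that] step by (auto simp: e_def)
  ultimately show ?case using step by (intro conjI exI[of _ e]) auto
qed

text \<open>Moving the optimal plan by a small multiple \<open>t\<close> of the direction given by
  the closed chain yields another plan, whose cost differs by \<open>t * r\<close>.\<close>

lemma optimal_plan_closed_chain:
  fixes c :: "'a \<Rightarrow> 'a \<Rightarrow> real"
  assumes R: "finite R" and \<pi>: "\<pi> \<in> plans R p q"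
    and opt: "\<And>\<rho>. \<rho> \<in> plans R p q \<Longrightarrow>
      (\<Sum>z\<in>R\<times>R. \<pi> z * c (fst z) (snd z)) \<le> (\<Sum>z\<in>R\<times>R. \<rho> z * c (fst z) (snd z))"
    and chain: "alt_chain c {z. 0 < \<pi> z} R x0 x0 r" and x0: "x0 \<in> R"
  shows "0 \<le> r"
proof -
  have S: "{z. 0 < \<pi> z} \<subseteq> R \<times> R"
    using \<pi> unfolding plans_def by (metis (mono_tags, lifting) less_irrefl mem_Collect_eq subsetI)
  have \<pi>0: "0 \<le> \<pi> z" for z using \<pi> unfolding plans_def by blast
  obtain d where d: "\<And>z. z \<notin> R \<times> R \<Longrightarrow> d z = 0" "\<And>z. \<not> 0 < \<pi> z \<Longrightarrow> 0 \<le> d z"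
    "\<And>i. i \<in> R \<Longrightarrow> (\<Sum>j\<in>R. d (i, j)) = 0"
    "\<And>j. j \<in> R \<Longrightarrow> (\<Sum>i\<in>R. d (i, j)) = 0"
    "(\<Sum>z\<in>R\<times>R. d z * c (fst z) (snd z)) = r"
    using alt_chain_perturbation[OF chain R S x0] unfolding diff_self mem_Collect_eq by blast
  \<comment> \<open>The direction is negative only where \<pi> is positive, so each of the finitely
    many constraints holds for all small \<open>t > 0\<close>.\<close>
  have "\<exists>t>0. \<forall>z\<in>R\<times>R. 0 \<le> \<pi> z + t * d z"
  proof -
    have "\<forall>\<^sub>F t in at_right 0. \<forall>z\<in>R\<times>R. 0 \<le> \<pi> z + t * d z"
    proof (intro eventually_ball_finite ballI)
      show "finite (R \<times> R)" using R by simp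
      fix z
      show "\<forall>\<^sub>F t in at_right 0. 0 \<le> \<pi> z + t * d z"
      proof (cases "0 < \<pi> z")
        case True
        have "((\<lambda>t. \<pi> z + t * d z) \<longlongrightarrow> \<pi> z + 0 * d z) (at_right 0)" by (intro tendsto_intros)
        with True have "\<forall>\<^sub>F t in at_right 0. 0 < \<pi> z + t * d z" by (intro order_tendstoD) auto
        then show ?thesis by eventually_elim simp
      next
        case False
        show ?thesis using eventually_at_right_less[of 0]
          by eventually_elim (use d(2)[OF False] \<pi>0 in simp)
      qed
    qed
    with eventually_at_right_less[of "0::real"]
    have "\<forall>\<^sub>F t in at_right (0::real). 0 < t \<and> (\<forall>z\<in>R\<times>R. 0 \<le> \<pi> z + t * d z)" by eventually_elim simp
    then have "\<exists>t>0. \<forall>z\<in>R\<times>R. 0 \<le> \<pi> z + t * d z"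
      using eventually_happens'[OF trivial_limit_at_right_real] by blast
    then show ?thesis .
  qed
  then obtain t where t: "0 < t" "\<And>z. z \<in> R \<times> R \<Longrightarrow> 0 \<le> \<pi> z + t * d z" by auto
  have "(\<lambda>z. \<pi> z + t * d z) \<in> plans R p q"
    unfolding plans_def
  proof (intro CollectI conjI allI impI ballI)
    show "0 \<le> \<pi> z + t * d z" for z
      using t(2)[of z] d(1)[of z] \<pi>0[of z] by (cases "z \<in> R \<times> R") auto
    show "\<pi> z + t * d z = 0" if "z \<notin> R \<times> R" for z
    proof -
      have "\<pi> z = 0" using that \<pi> unfolding plans_def by blast
      with d(1)[OF that] show ?thesis by simp
    qed
    show "(\<Sum>j\<in>R. \<pi> (i, j) + t * d (i, j)) = p i" if "i \<in> R" for i
      using that \<pi> by (simp add: plans_def sum.distrib sum_distrib_left[symmetric] d)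
    show "(\<Sum>i\<in>R. \<pi> (i, j) + t * d (i, j)) = q j" if "j \<in> R" for j
      using that \<pi> by (simp add: plans_def sum.distrib sum_distrib_left[symmetric] d)
  qed
  from opt[OF this] have "0 \<le> t * r"
    by (simp add: d(5)[symmetric] algebra_simps sum.distrib sum_distrib_left)
  with t(1) show ?thesis by (simp add: zero_le_mult_iff)
qed

text \<open>A linear cost attains its minimum on the plans, which form a closed subset of a product
  of compact intervals.\<close>

lemma optimal_plan_exists:
  fixes f :: "'a \<times> 'a \<Rightarrow> real"
  assumes R: "finite R" and ne: "plans R p q \<noteq> {}"
  obtains \<pi> where "\<pi> \<in> plans R p q"
    "\<And>\<rho>. \<rho> \<in> plans R p q \<Longrightarrow> (\<Sum>z\<in>R\<times>R. \<pi> z * f z) \<le> (\<Sum>z\<in>R\<times>R. \<rho> z * f z)"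
proof -
  \<comment> \<open>An entry of a plan is at most the sum of its row, hence the bound
    \<open>p (fst z)\<close>.\<close>
  define B where "B = (\<lambda>z. if z \<in> R \<times> R then {0..p (fst z)} else {0::real})"
  have "compactin (product_topology (\<lambda>_::'a \<times> 'a. euclidean) UNIV) (PiE UNIV B)"
    by (subst compactin_PiE) (auto simp: B_def)
  then have B: "compact (PiE UNIV B)"
    by (simp add: euclidean_product_topology)
  define E where "E = {\<pi>::'a \<times> 'a \<Rightarrow> real. (\<forall>i\<in>R. (\<Sum>j\<in>R. \<pi> (i, j)) = p i) \<and> (\<forall>j\<in>R. (\<Sum>i\<in>R. \<pi> (i, j)) = q j)}"
  have "closed E"
    unfolding E_def Ball_def
    by (intro closed_Collect_conj closed_Collect_all closed_Collect_imp closed_Collect_eq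
        continuous_intros open_Collect_const) auto
  have eq: "plans R p q = PiE UNIV B \<inter> E"
  proof -
    have "\<pi> (i, j) \<le> p i" if "\<pi> \<in> plans R p q" "i \<in> R" "j \<in> R" for \<pi> i j
    proof -
      have "\<pi> (i, j) \<le> (\<Sum>j\<in>R. \<pi> (i, j))"
        using that R by (intro member_le_sum) (auto simp: plans_def)
      with that show ?thesis by (auto simp: plans_def)
    qed
    then have "plans R p q \<subseteq> PiE UNIV B \<inter> E"
      by (auto simp: B_def) (auto simp: plans_def E_def)
    moreover have "PiE UNIV B \<inter> E \<subseteq> plans R p q"
    proof
      fix \<pi> assume \<pi>: "\<pi> \<in> PiE UNIV B \<inter> E"
      then have "\<pi> z \<in> B z" for z by auto
      then have "0 \<le> \<pi> z" "z \<notin> R \<times> R \<Longrightarrow> \<pi> z = 0" for z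
        unfolding B_def by (metis atLeastAtMost_iff order_refl singletonD, metis singletonD)
      with \<pi> show "\<pi> \<in> plans R p q" by (simp add: plans_def E_def)
    qed
    ultimately show ?thesis by blast
  qed
  have "compact (plans R p q)"
    unfolding eq using B \<open>closed E\<close> by (rule compact_Int_closed)
  moreover have "continuous_on (plans R p q) (\<lambda>\<pi>. \<Sum>z\<in>R\<times>R. \<pi> z * f z)"
    by (intro continuous_intros)
      (metis UNIV_I continuous_on_subset continuous_on_product_coordinates subset_UNIV)
  ultimately show ?thesis
    using continuous_attains_inf[OF _ ne] that by blast
qed

section \<open>Limits of laws of finitely valued processes\<close>

text \<open>Cantor's diagonal argument: compactness of \<open>{a..b}\<close> settles the indices one
  at a time along an enumeration of \<open>I\<close>. The diagonal sequence is a subsequence of each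
  extraction up to finitely many terms, which do not affect convergence.\<close>

lemma common_convergent_subsequence:
  fixes X :: "nat \<Rightarrow> 'i \<Rightarrow> real"
  assumes I: "countable I" and bdd: "\<And>n i. i \<in> I \<Longrightarrow> X n i \<in> {a..b}"
  obtains r :: "nat \<Rightarrow> nat" where "strict_mono r" "\<And>i. i \<in> I \<Longrightarrow> convergent (\<lambda>n. X (r n) i)"
proof (cases "I = {}")
  case True
  then show ?thesis using that[of id] by (auto simp: strict_mono_def)
next
  case False
  define e where "e = from_nat_into I"
  have e: "range e = I" using False I by (simp add: e_def range_from_nat_into)
  interpret subseqs "\<lambda>k s. convergent (\<lambda>n. X (s n) (e k))"
  proof
    fix k and s :: "nat \<Rightarrow> nat"
    have "\<forall>n. X (s n) (e k) \<in> {a..b}" using bdd e by blast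
    then obtain l r where "strict_mono r" "((\<lambda>n. X (s n) (e k)) \<circ> r) \<longlonglongrightarrow> l"
      using compact_Icc[THEN compact_imp_seq_compact, of a b] unfolding seq_compact_def by metis
    then show "\<exists>r. strict_mono r \<and> convergent (\<lambda>n. X ((s \<circ> r) n) (e k))"
      by (auto simp: convergent_def o_def)
  qed
  have "convergent (\<lambda>n. X (diagseq n) (e k))" for k
  proof -
    have "convergent (\<lambda>n. X ((diagseq \<circ> ((+) (Suc k))) n) (e k))"
    proof (rule diagseq_holds)
      fix r s :: "nat \<Rightarrow> nat" and n
      assume "strict_mono r" "convergent (\<lambda>i. X (s i) (e n))"
      from convergent_subseq_convergent[OF this(2,1)]
      show "convergent (\<lambda>i. X ((s \<circ> r) i) (e n))" by (simp add: o_def)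
    qed
    then have "convergent (\<lambda>n. X (diagseq (n + Suc k)) (e k))" by (simp add: o_def ac_simps)
    then show ?thesis by (subst (asm) convergent_ignore_initial_segment[of "\<lambda>n. X (diagseq n) (e k)"])
  qed
  with e subseq_diagseq show ?thesis by (intro that) auto
qed

text \<open>With finitely many values, the limits \<open>w a\<close> of the point probabilities
  determine the limits for all events by finite sums. The limit law is therefore the atomic measure
  with weights \<open>w a\<close>, and no mass is lost.\<close>

lemma finite_range_limit_law:
  fixes K :: "nat \<Rightarrow> 'z measure"
  assumes K: "\<And>n. prob_space (K n)" and sp: "\<And>n. space (K n) = \<Omega>"
    and fin: "finite (g ` \<Omega>)" and g: "g ` \<Omega> \<subseteq> space N"
    and ev: "\<And>n Y. {z\<in>\<Omega>. g z \<in> Y} \<in> sets (K n)"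
    and conv: "\<And>Y. convergent (\<lambda>n. measure (K n) {z\<in>\<Omega>. g z \<in> Y})"
  shows "\<exists>\<mu>. prob_space \<mu> \<and> sets \<mu> = sets N \<and>
    (\<forall>Y\<in>sets N. (\<lambda>n. measure (K n) {z\<in>\<Omega>. g z \<in> Y}) \<longlonglongrightarrow> measure \<mu> Y)"
proof -
  define w where "w a = lim (\<lambda>n. measure (K n) {z\<in>\<Omega>. g z \<in> {a}})" for a
  have w: "(\<lambda>n. measure (K n) {z\<in>\<Omega>. g z \<in> {a}}) \<longlonglongrightarrow> w a" for a
    unfolding w_def using conv[of "{a}"] by (simp only: convergent_LIMSEQ_iff)
  have w0: "0 \<le> w a" for a
    by (rule LIMSEQ_le_const[OF w]) auto
  \<comment> \<open>\<open>point_measure\<close> lives on all subsets of the range of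
    \<open>g\<close>; the image under \<open>id\<close> transfers it to the sigma-algebra of
    \<open>N\<close>.\<close>
  define p where "p = point_measure (g ` \<Omega>) (\<lambda>a. ennreal (w a))"
  define \<mu> where "\<mu> = distr p N id"
  have lim: "(\<lambda>n. measure (K n) {z\<in>\<Omega>. g z \<in> Y}) \<longlonglongrightarrow> (\<Sum>a\<in>Y \<inter> g ` \<Omega>. w a)" for Y
  proof -
    have "measure (K n) {z\<in>\<Omega>. g z \<in> Y} = (\<Sum>a\<in>Y \<inter> g ` \<Omega>. measure (K n) {z\<in>\<Omega>. g z \<in> {a}})" for n
    proof -
      interpret prob_space "K n" by fact
      have "{z\<in>\<Omega>. g z \<in> Y} = (\<Union>a\<in>Y \<inter> g ` \<Omega>. {z\<in>\<Omega>. g z \<in> {a}})" by auto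
      moreover have "{z\<in>\<Omega>. g z \<in> {a}} \<in> sets (K n)" for a by (rule ev)
      ultimately show ?thesis
        using fin by (simp only:, intro finite_measure_finite_Union) (auto simp: disjoint_family_on_def)
    qed
    then show ?thesis by (simp only:) (intro tendsto_sum w)
  qed
  have p: "id \<in> measurable p N" using g by (auto simp: p_def)
  have \<mu>: "measure \<mu> Y = (\<Sum>a\<in>Y \<inter> g ` \<Omega>. w a)" if "Y \<in> sets N" for Y
    using that fin unfolding \<mu>_def
    by (subst measure_distr[OF p])
      (auto simp: p_def space_point_measure measure_point_measure_finite_if w0)
  have emu: "emeasure \<mu> (space \<mu>) = ennreal (\<Sum>a\<in>g ` \<Omega>. w a)"
    using g fin unfolding \<mu>_def
    by (subst emeasure_distr[OF p])
      (auto simp: p_def space_point_measure emeasure_point_measure_finite w0 sum_ennreal Int_absorb1)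
  have "(\<lambda>n. measure (K n) {z\<in>\<Omega>. g z \<in> UNIV}) \<longlonglongrightarrow> 1"
    using K sp by (auto intro!: tendsto_eventually simp: prob_space.prob_space[OF K, unfolded sp])
  with lim[of UNIV] have "(\<Sum>a\<in>g ` \<Omega>. w a) = 1"
    by (simp add: LIMSEQ_unique)
  then have "prob_space \<mu>" using emu by (intro prob_spaceI) simp
  with lim \<mu> show ?thesis by (intro exI[of _ \<mu>]) (auto simp: \<mu>_def)
qed

text \<open>Each finite block of the \<open>G i\<close> takes finitely many values, so only
  countably many events have to be considered and one subsequence makes all their probabilities
  converge. The limit laws of the blocks are consistent, and Kolmogorov's extension theorem joins
  them into one law on sequences.\<close>

lemma kolmogorov_limit_law:
  fixes K :: "nat \<Rightarrow> 'z measure" and G :: "nat \<Rightarrow> 'z \<Rightarrow> 'b::polish_space"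
  assumes K: "\<And>n. prob_space (K n)" and sp: "\<And>n. sets (K n) = sets M"
    and G: "\<And>i. simple_function M (G i)"
  obtains \<mu> :: "(nat \<Rightarrow> 'b) measure" and r :: "nat \<Rightarrow> nat"
  where "prob_space \<mu>" "sets \<mu> = sets (PiM UNIV (\<lambda>_. borel))" "strict_mono r"
    "\<And>J X. finite J \<Longrightarrow> X \<in> sets (PiM J (\<lambda>_. borel)) \<Longrightarrow>
      (\<lambda>n. measure (K (r n)) {z\<in>space M. (\<lambda>i\<in>J. G i z) \<in> X}) \<longlonglongrightarrow> measure \<mu> {h. restrict h J \<in> X}"
proof -
  let ?\<Omega> = "space M"
  define g where "g k z = (\<lambda>i\<in>{..<k}. G i z)" for k :: nat and z
  have fin_restrict: "finite ((\<lambda>z. \<lambda>i\<in>J. G i z) ` ?\<Omega>)" if "finite J" for J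
    by (rule finite_subset[of _ "PiE J (\<lambda>i. G i ` ?\<Omega>)"])
      (use that G in \<open>auto intro!: finite_PiE simp: simple_function_def\<close>)
  have ev: "{z\<in>?\<Omega>. (\<lambda>i\<in>J. G i z) \<in> Y} \<in> sets M" if J: "finite J" for J Y
  proof -
    \<comment> \<open>The set \<open>Y\<close> is arbitrary here; the event is measurable as a
      finite union over the values that the block takes in \<open>Y\<close>.\<close>
    have "{z\<in>?\<Omega>. (\<lambda>i\<in>J. G i z) \<in> Y} = (\<Union>a\<in>Y \<inter> (\<lambda>z. \<lambda>i\<in>J. G i z) ` ?\<Omega>. {z\<in>?\<Omega>. \<forall>i\<in>J. G i z = a i})"
    proof -
      have "(\<lambda>i\<in>J. G i z) = (\<lambda>i\<in>J. G i z') \<longleftrightarrow> (\<forall>i\<in>J. G i z = (\<lambda>i\<in>J. G i z') i)" for z z'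
        by (auto simp: fun_eq_iff)
      then have "{z\<in>?\<Omega>. \<forall>i\<in>J. G i z = a i} = {z\<in>?\<Omega>. (\<lambda>i\<in>J. G i z) = a}"
        if "a \<in> (\<lambda>z. \<lambda>i\<in>J. G i z) ` ?\<Omega>" for a
        using that by blast
      then have "(\<Union>a\<in>Y \<inter> (\<lambda>z. \<lambda>i\<in>J. G i z) ` ?\<Omega>. {z\<in>?\<Omega>. \<forall>i\<in>J. G i z = a i})
          = (\<Union>a\<in>Y \<inter> (\<lambda>z. \<lambda>i\<in>J. G i z) ` ?\<Omega>. {z\<in>?\<Omega>. (\<lambda>i\<in>J. G i z) = a})"
        by (intro SUP_cong refl) blast
      moreover have "{z\<in>?\<Omega>. \<phi> z \<in> Y} = (\<Union>a\<in>Y \<inter> \<phi> ` ?\<Omega>. {z\<in>?\<Omega>. \<phi> z = a})" for \<phi> :: "'z \<Rightarrow> nat \<Rightarrow> 'b"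
        by auto
      ultimately show ?thesis by simp
    qed
    also have "\<dots> \<in> sets M"
    proof (intro sets.finite_UN)
      show "finite (Y \<inter> (\<lambda>z. \<lambda>i\<in>J. G i z) ` ?\<Omega>)" using fin_restrict[OF J] by blast
      show "{z \<in> ?\<Omega>. \<forall>i\<in>J. G i z = a i} \<in> sets M" for a
      proof (intro sets.sets_Collect_finite_All J)
        show "{z \<in> ?\<Omega>. G i z = a i} \<in> sets M" for i
          using simple_functionD(2)[OF G, of i "{a i}"] by (simp add: vimage_def Int_def conj_commute)
      qed
    qed
    finally show ?thesis .
  qed
  \<comment> \<open>These events depend on the first \<open>k\<close> functions. Only the trace of
    \<open>Y\<close> on the finite range of \<open>g k\<close> matters, which leaves finitely many
    events for each \<open>k\<close>; every finite \<open>J\<close> lies in some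
    \<open>{..<k}\<close>.\<close>
  define \<E> where "\<E> = (\<Union>k. (\<lambda>Y. {z\<in>?\<Omega>. g k z \<in> Y}) ` UNIV)"
  have "countable \<E>"
    unfolding \<E>_def
  proof (rule countable_UN)
    fix k
    have "range (\<lambda>Y. {z\<in>?\<Omega>. g k z \<in> Y}) \<subseteq> (\<lambda>Y. {z\<in>?\<Omega>. g k z \<in> Y}) ` Pow (g k ` ?\<Omega>)"
    proof safe
      fix Y
      show "{z\<in>?\<Omega>. g k z \<in> Y} \<in> (\<lambda>Y. {z\<in>?\<Omega>. g k z \<in> Y}) ` Pow (g k ` ?\<Omega>)"
        by (rule image_eqI[of _ _ "Y \<inter> g k ` ?\<Omega>"]) auto
    qed
    moreover have "finite (Pow (g k ` ?\<Omega>))" using fin_restrict[of "{..<k}"] by (simp add: g_def)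
    ultimately show "countable (range (\<lambda>Y. {z\<in>?\<Omega>. g k z \<in> Y}))"
      by (meson countable_finite finite_imageI finite_subset)
  qed simp
  then obtain r where r: "strict_mono r" "\<And>E. E \<in> \<E> \<Longrightarrow> convergent (\<lambda>n. measure (K (r n)) E)"
    using common_convergent_subsequence[of \<E> "\<lambda>n. measure (K n)" 0 1] K
    by (metis atLeastAtMost_iff measure_nonneg prob_space.prob_le_1)
  have conv: "convergent (\<lambda>n. measure (K (r n)) {z\<in>?\<Omega>. (\<lambda>i\<in>J. G i z) \<in> Y})" if J: "finite J" for J Y
  proof (rule r(2))
    obtain k where k: "J \<subseteq> {..<k}" using J finite_nat_iff_bounded by blast
    then have "{z\<in>?\<Omega>. (\<lambda>i\<in>J. G i z) \<in> Y} = {z\<in>?\<Omega>. g k z \<in> {h. restrict h J \<in> Y}}"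
      by (auto simp: g_def restrict_restrict Int_absorb1)
    then show "{z\<in>?\<Omega>. (\<lambda>i\<in>J. G i z) \<in> Y} \<in> \<E>" unfolding \<E>_def by blast
  qed
  have ex: "\<exists>\<mu>. prob_space \<mu> \<and> sets \<mu> = sets (PiM J (\<lambda>_. borel :: 'b measure)) \<and>
    (\<forall>Y\<in>sets (PiM J (\<lambda>_. borel)). (\<lambda>n. measure (K (r n)) {z\<in>?\<Omega>. (\<lambda>i\<in>J. G i z) \<in> Y}) \<longlonglongrightarrow> measure \<mu> Y)"
    if J: "finite J" for J
  proof (rule finite_range_limit_law)
    show "prob_space (K (r n))" "space (K (r n)) = ?\<Omega>" for n using K sp by (auto dest: sets_eq_imp_space_eq)
    show "finite ((\<lambda>z. \<lambda>i\<in>J. G i z) ` ?\<Omega>)" by (rule fin_restrict[OF J])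
    show "(\<lambda>z. \<lambda>i\<in>J. G i z) ` ?\<Omega> \<subseteq> space (PiM J (\<lambda>_. borel))" by (auto simp: space_PiM)
  qed (use ev[OF J] sp conv[OF J] in auto)
  define L where "L J = (SOME \<mu>. prob_space \<mu> \<and> sets \<mu> = sets (PiM J (\<lambda>_. borel :: 'b measure)) \<and>
    (\<forall>Y\<in>sets (PiM J (\<lambda>_. borel)). (\<lambda>n. measure (K (r n)) {z\<in>?\<Omega>. (\<lambda>i\<in>J. G i z) \<in> Y}) \<longlonglongrightarrow> measure \<mu> Y))" for J
  have L: "prob_space (L J)" "sets (L J) = sets (PiM J (\<lambda>_. borel))"
      "Y \<in> sets (PiM J (\<lambda>_. borel)) \<Longrightarrow>
        (\<lambda>n. measure (K (r n)) {z\<in>?\<Omega>. (\<lambda>i\<in>J. G i z) \<in> Y}) \<longlonglongrightarrow> measure (L J) Y" if "finite J" for J Y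
    using someI_ex[OF ex[OF that]] unfolding L_def[symmetric] by blast+
  interpret polish_projective UNIV L
  proof (intro polish_projective.intro projective_family.intro)
    show "prob_space (L J)" if "finite J" for J using L(1)[OF that] .
    fix J H :: "nat set" assume JH: "J \<subseteq> H" and H: "finite H"
    have J: "finite J" using JH H by (rule finite_subset)
    interpret LJ: prob_space "L J" by (rule L(1)[OF J])
    interpret LH: prob_space "L H" by (rule L(1)[OF H])
    have m: "(\<lambda>f. restrict f J) \<in> measurable (L H) (PiM J (\<lambda>_. borel :: 'b measure))"
      using measurable_restrict_subset[OF JH] by (simp cong: measurable_cong_sets add: L(2)[OF H])
    show "L J = distr (L H) (PiM J (\<lambda>_. borel)) (\<lambda>f. restrict f J)"
    proof (rule measure_eqI)
      show "sets (L J) = sets (distr (L H) (PiM J (\<lambda>_. borel)) (\<lambda>f. restrict f J))" by (simp add: L(2)[OF J])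
      fix A assume "A \<in> sets (L J)"
      then have A: "A \<in> sets (PiM J (\<lambda>_. borel))" by (simp add: L(2)[OF J])
      let ?B = "(\<lambda>f. restrict f J) -` A \<inter> space (L H)"
      have B: "?B \<in> sets (PiM H (\<lambda>_. borel))"
        using measurable_sets[OF m A] by (simp add: L(2)[OF H])
      have spH: "space (L H) = PiE H (\<lambda>_. UNIV)"
        using sets_eq_imp_space_eq[OF L(2)[OF H]] by (simp add: space_PiM)
      \<comment> \<open>Consistency holds before the limit, because both sides are the same event of
        \<open>M\<close>; uniqueness of limits carries it over to \<open>L\<close>.\<close>
      have "{z\<in>?\<Omega>. (\<lambda>i\<in>H. G i z) \<in> ?B} = {z\<in>?\<Omega>. (\<lambda>i\<in>J. G i z) \<in> A}"
        using JH by (auto simp: spH restrict_restrict Int_absorb1)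
      with L(3)[OF H B] L(3)[OF J A] have "measure (L J) A = measure (L H) ?B"
        by (simp add: LIMSEQ_unique)
      then show "emeasure (L J) A = emeasure (distr (L H) (PiM J (\<lambda>_. borel)) (\<lambda>f. restrict f J)) A"
        using m A by (simp add: emeasure_distr LJ.emeasure_eq_measure LH.emeasure_eq_measure)
    qed
  qed
  show ?thesis
  proof (rule that)
    show "prob_space lim" by (rule P.prob_space_axioms)
    show "sets lim = sets (PiM UNIV (\<lambda>_. borel))" by simp
    fix J and X :: "(nat \<Rightarrow> 'b) set" assume J: "finite J" and X: "X \<in> sets (PiM J (\<lambda>_. borel))"
    have "prod_emb UNIV (\<lambda>_. borel) J X = {h. restrict h J \<in> X}"
      by (auto simp: prod_emb_def)
    with L(3)[OF J X] measure_lim_emb[OF _ J X]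
    show "(\<lambda>n. measure (K (r n)) {z\<in>?\<Omega>. (\<lambda>i\<in>J. G i z) \<in> X}) \<longlonglongrightarrow> measure lim {h. restrict h J \<in> X}"
      by simp
  qed (rule r(1))
qed

text \<open>Expectations become finite sums of point probabilities, so that convergence of the
  latter gives convergence of costs. The range condition is almost sure because that is how it is
  known for the coordinates under a limit law.\<close>

lemma finite_range_expectation:
  fixes f :: "'b::t1_space \<Rightarrow> real"
  assumes "prob_space M" and f: "f \<in> borel_measurable borel" and g: "g \<in> borel_measurable M" and A: "finite A" and AE: "AE z in M. g z \<in> A"
  shows "(\<integral>z. f (g z) \<partial>M) = (\<Sum>a\<in>A. f a * measure M {z\<in>space M. g z = a})"
proof -
  interpret prob_space M by fact
  have ev: "{z\<in>space M. g z = a} \<in> sets M" for a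
    using measurable_sets[OF g, of "{a}"] by (simp add: vimage_def Int_def conj_commute)
  have "(\<integral>z. f (g z) \<partial>M) = (\<integral>z. (\<Sum>a\<in>A. f a * indicator {z\<in>space M. g z = a} z) \<partial>M)"
  proof (rule integral_cong_AE)
    have eq: "f (g z) = (\<Sum>a\<in>A. f a * indicator {z\<in>space M. g z = a} z)" if "g z \<in> A" "z \<in> space M" for z
    proof -
      have "(\<Sum>a\<in>A. f a * indicator {z\<in>space M. g z = a} z) = (\<Sum>a\<in>A. if a = g z then f a else 0)"
        using that by (intro sum.cong) (auto simp: indicator_def)
      then show ?thesis using that A by simp
    qed
    show "AE z in M. f (g z) = (\<Sum>a\<in>A. f a * indicator {z\<in>space M. g z = a} z)"
      using AE AE_space by eventually_elim (rule eq)
    show "(\<lambda>z. \<Sum>a\<in>A. f a * indicator {z\<in>space M. g z = a} z) \<in> borel_measurable M"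
      using ev by measurable
    show "(\<lambda>z. f (g z)) \<in> borel_measurable M" using measurable_compose[OF g f] .
  qed
  also have "\<dots> = (\<Sum>a\<in>A. f a * measure M {z\<in>space M. g z = a})"
    using ev by (subst Bochner_Integration.integral_sum) (auto simp: emeasure_eq_measure Int_absorb1 sets.sets_into_space)
  finally show ?thesis .
qed

text \<open>For every \<open>n\<close> the law of the sequence \<open>F i (f z)\<close> under
  \<open>K n\<close> is the image of the fixed marginal \<open>P\<close>. The probabilities of
  finite-dimensional rectangles are thus constant in \<open>n\<close>, the limit keeps them, and
  they determine a law on sequences. The cases of interest are \<open>f = fst\<close> and
  \<open>f = snd\<close>.\<close>

lemma limit_law_marginal:
  fixes f :: "'b::polish_space \<Rightarrow> 'a::polish_space"
  assumes \<mu>: "prob_space \<mu>" "sets \<mu> = sets (PiM UNIV (\<lambda>_::nat. borel :: 'b measure))"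
    and conv: "\<And>J X. finite J \<Longrightarrow> X \<in> sets (PiM J (\<lambda>_. borel)) \<Longrightarrow>
      (\<lambda>n. measure (K n) {z. (\<lambda>i\<in>J. G i z) \<in> X}) \<longlonglongrightarrow> measure \<mu> {h. restrict h J \<in> X}"
    and K: "\<And>n. prob_space (K n)" "\<And>n. sets (K n) = sets borel" "\<And>n. distr (K n) borel f = P"
    and f: "f \<in> borel_measurable borel" and F: "\<And>i. F i \<in> borel_measurable borel"
    and fG: "\<And>i z. f (G i z) = F i (f z)"
  shows "distr \<mu> (PiM UNIV (\<lambda>_. borel)) (\<lambda>h i. f (h i)) = distr P (PiM UNIV (\<lambda>_. borel)) (\<lambda>x i. F i x)"
    (is "?L = ?R")
proof (rule measure_eqI_PiM_infinite)
  interpret \<mu>: prob_space \<mu> by fact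
  have fK: "f \<in> borel_measurable (K n)" for n using f by (simp cong: measurable_cong_sets add: K)
  have "sets P = sets borel" using K(3)[of 0] by auto
  have P: "prob_space P" using prob_space.prob_space_distr[OF K(1) fK, of 0] by (simp add: K(3))
  interpret P: prob_space P by fact
  have mL: "(\<lambda>h i. f (h i)) \<in> measurable \<mu> (PiM UNIV (\<lambda>_. borel))"
  proof (rule measurable_PiM_single')
    fix i :: nat
    have "(\<lambda>h. h i) \<in> borel_measurable (PiM UNIV (\<lambda>_::nat. borel :: 'b measure))" by measurable
    from measurable_compose[OF this f] show "(\<lambda>h. f (h i)) \<in> borel_measurable \<mu>"
      by (simp cong: measurable_cong_sets add: \<mu>)
  qed auto
  have mR: "(\<lambda>x i. F i x) \<in> measurable P (PiM UNIV (\<lambda>_. borel))"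
    using F by (intro measurable_PiM_single') (auto cong: measurable_cong_sets simp: \<open>sets P = sets borel\<close>)
  show "finite_measure ?L" using \<mu>.prob_space_distr[OF mL] by (simp add: prob_space_def)
  fix A :: "nat \<Rightarrow> 'a set" and J :: "nat set"
  assume J: "finite J" and A: "\<And>i. i \<in> J \<Longrightarrow> A i \<in> sets borel"
  define X where "X = PiE J (\<lambda>i. f -` A i)"
  have X: "X \<in> sets (PiM J (\<lambda>_. borel))"
    unfolding X_def using J A measurable_sets[OF f] by (intro sets_PiM_I_finite) auto
  let ?E = "prod_emb UNIV (\<lambda>_. borel) J (PiE J A)"
  have E: "?E = {g. \<forall>i\<in>J. g i \<in> A i}" by (auto simp: prod_emb_def PiE_iff)
  have Esets: "?E \<in> sets (PiM UNIV (\<lambda>_. borel))" using J A by (intro sets_PiM_I) auto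
  have L: "measure ?L ?E = measure \<mu> {h. restrict h J \<in> X}"
    using sets_eq_imp_space_eq[OF \<mu>(2)]
    by (subst measure_distr[OF mL Esets], unfold E)
      (auto intro!: arg_cong[where f="measure \<mu>"] simp: X_def space_PiM PiE_iff)
  have "measure (K n) {z. (\<lambda>i\<in>J. G i z) \<in> X} = measure ?R ?E" for n
  proof -
    have sP: "space P = UNIV" using sets_eq_imp_space_eq[OF \<open>sets P = sets borel\<close>] by simp
    have sK: "space (K n) = UNIV" using sets_eq_imp_space_eq[OF K(2)] by simp
    have "measure ?R ?E = measure (distr (K n) borel f) ((\<lambda>x i. F i x) -` ?E \<inter> space P)"
      unfolding K(3) by (rule measure_distr[OF mR Esets])
    also have "\<dots> = measure (K n) (f -` ((\<lambda>x i. F i x) -` ?E \<inter> space P) \<inter> space (K n))"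
      using measurable_sets[OF mR Esets] by (intro measure_distr fK) (simp add: \<open>sets P = sets borel\<close>)
    also have "f -` ((\<lambda>x i. F i x) -` ?E \<inter> space P) \<inter> space (K n) = {z. (\<lambda>i\<in>J. G i z) \<in> X}"
      unfolding E by (auto simp: sP sK X_def PiE_iff fG)
    finally show ?thesis by simp
  qed
  with conv[OF J X] have "measure ?L ?E = measure ?R ?E" by (simp add: L LIMSEQ_const_iff)
  then show "emeasure ?L ?E = emeasure ?R ?E"
    using \<mu>.prob_space_distr[OF mL] P.prob_space_distr[OF mR]
    by (simp add: finite_measure.emeasure_eq_measure prob_space_def)
qed auto

section \<open>Couplings\<close>

lemma couplingsD:
  assumes "\<kappa> \<in> couplings P Q"
  shows "prob_space \<kappa>" "sets \<kappa> = sets borel" "space \<kappa> = UNIV" "distr \<kappa> borel fst = P" "distr \<kappa> borel snd = Q"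
    "fst \<in> borel_measurable \<kappa>" "snd \<in> borel_measurable \<kappa>"
proof -
  show *: "sets \<kappa> = sets borel" using assms unfolding couplings_def borel_prod by blast
  show "space \<kappa> = UNIV" using sets_eq_imp_space_eq[OF *] by simp
  show "fst \<in> borel_measurable \<kappa>" "snd \<in> borel_measurable \<kappa>"
    by (simp_all cong: measurable_cong_sets add: * borel_measurable_continuous_onI continuous_on_fst continuous_on_snd)
qed (use assms in \<open>auto simp: couplings_def\<close>)

lemma coupling_integral_diff:
  assumes \<kappa>: "\<kappa> \<in> couplings P Q" and f: "f \<in> borel_measurable borel" and i: "integrable P f" "integrable Q f"
  shows "integrable \<kappa> (\<lambda>z. f (fst z) - f (snd z))"
    "(\<integral>z. f (fst z) - f (snd z) \<partial>\<kappa>) = (\<integral>x. f x \<partial>P) - (\<integral>x. (f x :: real) \<partial>Q)"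
proof -
  note k = couplingsD[OF \<kappa>]
  have "integrable \<kappa> (\<lambda>z. f (fst z))" "integrable \<kappa> (\<lambda>z. f (snd z))"
    using i k by (auto intro: integrable_distr)
  moreover have "(\<integral>z. f (fst z) \<partial>\<kappa>) = (\<integral>x. f x \<partial>P)" "(\<integral>z. f (snd z) \<partial>\<kappa>) = (\<integral>x. f x \<partial>Q)"
    using integral_distr[OF k(6) f] integral_distr[OF k(7) f] by (simp_all add: k)
  ultimately show "integrable \<kappa> (\<lambda>z. f (fst z) - f (snd z))"
    "(\<integral>z. f (fst z) - f (snd z) \<partial>\<kappa>) = (\<integral>x. f x \<partial>P) - (\<integral>x. f x \<partial>Q)" by simp_all
qed

section \<open>Spreading a finite plan over the cells of a simple function\<close>

lemma nn_integral_normalized_cells: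
  fixes F :: "'a::euclidean_space \<Rightarrow> 'a"
  assumes "prob_space Q" and sets: "sets Q = sets borel" and F: "simple_function borel F"
    and g: "\<And>j. 0 \<le> g j" "\<And>j. j \<in> range F \<Longrightarrow> measure Q (F -` {j}) = 0 \<Longrightarrow> g j = 0"
  shows "(\<integral>\<^sup>+y. ennreal (g (F y) / measure Q (F -` {F y})) \<partial>Q) = ennreal (\<Sum>j\<in>range F. g j)"
proof -
  interpret prob_space Q by fact
  have fin: "finite (range F)" using F by (simp add: simple_function_def)
  have cell: "F -` {j} \<in> sets Q" for j
    using simple_functionD(2)[OF F, of "{j}"] by (simp add: sets)
  \<comment> \<open>Integrating \<open>h\<close> over the cell of \<open>j\<close> returns the
    weight \<open>g j\<close>. On a null cell the quotient is 0 by convention, which is consistent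
    because \<open>g j = 0\<close> there.\<close>
  define h where "h j = g j / measure Q (F -` {j})" for j
  have h: "0 \<le> h j" for j using g(1) by (simp add: h_def)
  have "ennreal (h (F y)) = (\<Sum>j\<in>range F. ennreal (h j) * indicator (F -` {j}) y)" for y
  proof -
    have "(\<Sum>j\<in>range F. ennreal (h j) * indicator (F -` {j}) y) = (\<Sum>j\<in>range F. if j = F y then ennreal (h j) else 0)"
      by (intro sum.cong) (auto simp: indicator_def)
    then show ?thesis using fin by simp
  qed
  then have "(\<integral>\<^sup>+y. ennreal (h (F y)) \<partial>Q) = (\<Sum>j\<in>range F. ennreal (h j) * emeasure Q (F -` {j}))"
    using cell by (simp add: nn_integral_sum nn_integral_cmult_indicator)
  also have "\<dots> = (\<Sum>j\<in>range F. ennreal (g j))"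
    using g by (intro sum.cong refl) (auto simp: emeasure_eq_measure ennreal_mult[symmetric] h h_def)
  finally show ?thesis using g(1) by (simp add: h_def)
qed

text \<open>There are finitely many cells, so those of measure zero have a null union.\<close>

lemma AE_cell_positive:
  fixes F :: "'a::euclidean_space \<Rightarrow> 'a"
  assumes "prob_space P" and sets: "sets P = sets borel" and F: "simple_function borel F"
  shows "AE x in P. measure P (F -` {F x}) \<noteq> 0"
proof -
  interpret prob_space P by fact
  have fin: "finite (range F)" using F by (simp add: simple_function_def)
  have cell: "F -` {j} \<in> sets P" for j
    using simple_functionD(2)[OF F, of "{j}"] by (simp add: sets)
  have "AE x in P. x \<notin> F -` {i}" if "measure P (F -` {i}) = 0" for i
    using that cell by (intro AE_not_in) (auto simp: null_sets_def emeasure_eq_measure)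
  then have "AE x in P. \<forall>i\<in>range F. measure P (F -` {i}) = 0 \<longrightarrow> F x \<noteq> i"
    using fin by (intro AE_finite_allI) auto
  then show ?thesis by eventually_elim auto
qed

text \<open>Inside each pair of cells the mass prescribed by \<pi> is distributed proportionally to
  \<open>P \<Otimes>\<^sub>M Q\<close>. Integrating out one variable gives density 1 in the other,
  so the marginals are exactly \<open>P\<close> and \<open>Q\<close>, while the mass stays on pairs
  of cells charged by \<pi>.\<close>

lemma glue_plan:
  fixes F :: "real ^ 'd \<Rightarrow> real ^ 'd"
  assumes P: "prob_space P" "sets P = sets borel" and Q: "prob_space Q" "sets Q = sets borel"
    and F: "simple_function borel F"
    and \<pi>: "\<pi> \<in> plans (range F) (\<lambda>i. measure P (F -` {i})) (\<lambda>j. measure Q (F -` {j}))"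
  obtains \<kappa> where "\<kappa> \<in> couplings P Q" "AE z in \<kappa>. 0 < \<pi> (F (fst z), F (snd z))"
proof -
  interpret P: prob_space P by fact
  interpret Q: prob_space Q by fact
  interpret pair_sigma_finite P Q ..
  let ?R = "range F"
  define p where "p i = measure P (F -` {i})" for i
  define q where "q j = measure Q (F -` {j})" for j
  have fin: "finite ?R" using F by (simp add: simple_function_def)
  have \<pi>0: "0 \<le> \<pi> z" for z using \<pi> unfolding plans_def by blast
  have row: "(\<Sum>j\<in>?R. \<pi> (i, j)) = p i" if "i \<in> ?R" for i using \<pi> that unfolding plans_def p_def by blast
  have col: "(\<Sum>i\<in>?R. \<pi> (i, j)) = q j" if "j \<in> ?R" for j using \<pi> that unfolding plans_def q_def by blast
  \<comment> \<open>Nonnegative entries with sum zero vanish; this provides the condition on null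
    cells in \<open>nn_integral_normalized_cells\<close>.\<close>
  have row0: "\<pi> (i, j) = 0" if "i \<in> ?R" "j \<in> ?R" "p i = 0" for i j
    using row[OF that(1)] that sum_nonneg_eq_0_iff[OF fin, of "\<lambda>j. \<pi> (i, j)"] \<pi>0 by (simp del: image_iff) blast
  have col0: "\<pi> (i, j) = 0" if "i \<in> ?R" "j \<in> ?R" "q j = 0" for i j
    using col[OF that(2)] that sum_nonneg_eq_0_iff[OF fin, of "\<lambda>i. \<pi> (i, j)"] \<pi>0 by (simp del: image_iff) blast
  define w where "w z = ennreal (\<pi> (F (fst z), F (snd z)) / (p (F (fst z)) * q (F (snd z))))" for z
  have mF: "F \<in> borel_measurable borel" by (rule borel_measurable_simple_function[OF F])
  have mf: "fst \<in> measurable (P \<Otimes>\<^sub>M Q) borel" "snd \<in> measurable (P \<Otimes>\<^sub>M Q) borel"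
    using measurable_fst[of P Q] measurable_snd[of P Q] P(2) Q(2) by (simp_all cong: measurable_cong_sets)
  have "simple_function (P \<Otimes>\<^sub>M Q) (\<lambda>z. F (fst z))" "simple_function (P \<Otimes>\<^sub>M Q) (\<lambda>z. F (snd z))"
    using measurable_compose[OF mf(1) mF] measurable_compose[OF mf(2) mF]
    by (auto intro!: simple_function_borel_measurable intro: finite_subset[OF _ fin])
  then have sw: "simple_function (P \<Otimes>\<^sub>M Q) (\<lambda>z. (F (fst z), F (snd z)))"
    by (rule simple_function_Pair)
  have w: "w \<in> borel_measurable (P \<Otimes>\<^sub>M Q)"
    unfolding w_def using simple_function_compose1[OF sw, of "\<lambda>a. ennreal (\<pi> a / (p (fst a) * q (snd a)))"]
    by (intro borel_measurable_simple_function) simp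
  define \<kappa> where "\<kappa> = density (P \<Otimes>\<^sub>M Q) w"
  have kernel1: "AE x in P. (\<integral>\<^sup>+y. w (x, y) \<partial>Q) = 1"
    using AE_cell_positive[OF P F]
  proof eventually_elim
    case (elim x)
    have "(\<integral>\<^sup>+y. w (x, y) \<partial>Q) = (\<integral>\<^sup>+y. ennreal (\<pi> (F x, F y) / p (F x) / measure Q (F -` {F y})) \<partial>Q)"
      by (simp add: w_def q_def)
    also have "\<dots> = ennreal (\<Sum>j\<in>?R. \<pi> (F x, j) / p (F x))"
      by (rule nn_integral_normalized_cells[OF Q F]) (auto simp: \<pi>0 p_def col0 q_def)
    also have "(\<Sum>j\<in>?R. \<pi> (F x, j) / p (F x)) = 1"
      using row[of "F x"] elim by (simp add: sum_divide_distrib[symmetric] p_def)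
    finally show ?case by simp
  qed
  have kernel2: "AE y in Q. (\<integral>\<^sup>+x. w (x, y) \<partial>P) = 1"
    using AE_cell_positive[OF Q F]
  proof eventually_elim
    case (elim y)
    have "(\<integral>\<^sup>+x. w (x, y) \<partial>P) = (\<integral>\<^sup>+x. ennreal (\<pi> (F x, F y) / q (F y) / measure P (F -` {F x})) \<partial>P)"
      by (simp add: w_def p_def mult.commute)
    also have "\<dots> = ennreal (\<Sum>i\<in>?R. \<pi> (i, F y) / q (F y))"
      by (rule nn_integral_normalized_cells[OF P F]) (auto simp: \<pi>0 q_def row0 p_def)
    also have "(\<Sum>i\<in>?R. \<pi> (i, F y) / q (F y)) = 1"
      using col[of "F y"] elim by (simp add: sum_divide_distrib[symmetric] q_def)
    finally show ?case by simp
  qed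
  have spP: "space P = UNIV" and spQ: "space Q = UNIV"
    using sets_eq_imp_space_eq[OF P(2)] sets_eq_imp_space_eq[OF Q(2)] by simp_all
  have m\<kappa>: "fst \<in> measurable \<kappa> borel" "snd \<in> measurable \<kappa> borel" using mf by (simp_all add: \<kappa>_def)
  have d1: "distr \<kappa> borel fst = P"
  proof (rule measure_eqI)
    fix A :: "(real ^ 'd) set" assume "A \<in> sets (distr \<kappa> borel fst)"
    then have A: "A \<in> sets borel" by simp
    have i: "(\<lambda>z. w z * indicator A (fst z)) \<in> borel_measurable (P \<Otimes>\<^sub>M Q)"
      using w mf A by measurable
    have "emeasure (distr \<kappa> borel fst) A = emeasure \<kappa> (fst -` A \<inter> space \<kappa>)"
      by (rule emeasure_distr[OF m\<kappa>(1) A])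
    also have "\<dots> = (\<integral>\<^sup>+z. w z * indicator A (fst z) \<partial>(P \<Otimes>\<^sub>M Q))"
      using measurable_sets[OF mf(1) A] unfolding \<kappa>_def
      by (subst emeasure_density[OF w]) (auto intro!: nn_integral_cong simp: indicator_def)
    also have "\<dots> = (\<integral>\<^sup>+x. \<integral>\<^sup>+y. w (x, y) * indicator A x \<partial>Q \<partial>P)"
      using Q.nn_integral_fst[OF i] by simp
    also have "\<dots> = (\<integral>\<^sup>+x. (\<integral>\<^sup>+y. w (x, y) \<partial>Q) * indicator A x \<partial>P)"
      using measurable_Pair2[OF w] by (intro nn_integral_cong nn_integral_multc) simp
    also have "\<dots> = (\<integral>\<^sup>+x. indicator A x \<partial>P)"
      by (rule nn_integral_cong_AE, use kernel1 in eventually_elim) simp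
    also have "\<dots> = emeasure P A" using A P by simp
    finally show "emeasure (distr \<kappa> borel fst) A = emeasure P A" .
  qed (simp add: P)
  have d2: "distr \<kappa> borel snd = Q"
  proof (rule measure_eqI)
    fix A :: "(real ^ 'd) set" assume "A \<in> sets (distr \<kappa> borel snd)"
    then have A: "A \<in> sets borel" by simp
    have i: "(\<lambda>z. w z * indicator A (snd z)) \<in> borel_measurable (P \<Otimes>\<^sub>M Q)"
      using w mf A by measurable
    have "emeasure (distr \<kappa> borel snd) A = emeasure \<kappa> (snd -` A \<inter> space \<kappa>)"
      by (rule emeasure_distr[OF m\<kappa>(2) A])
    also have "\<dots> = (\<integral>\<^sup>+z. w z * indicator A (snd z) \<partial>(P \<Otimes>\<^sub>M Q))"
      using measurable_sets[OF mf(2) A] unfolding \<kappa>_def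
      by (subst emeasure_density[OF w]) (auto intro!: nn_integral_cong simp: indicator_def)
    also have "\<dots> = (\<integral>\<^sup>+y. \<integral>\<^sup>+x. w (x, y) * indicator A y \<partial>P \<partial>Q)"
      using nn_integral_snd[OF i] by simp
    also have "\<dots> = (\<integral>\<^sup>+y. (\<integral>\<^sup>+x. w (x, y) \<partial>P) * indicator A y \<partial>Q)"
      using measurable_Pair1[OF w] by (intro nn_integral_cong nn_integral_multc) simp
    also have "\<dots> = (\<integral>\<^sup>+y. indicator A y \<partial>Q)"
      by (rule nn_integral_cong_AE, use kernel2 in eventually_elim) simp
    also have "\<dots> = emeasure Q A" using A Q by simp
    finally show "emeasure (distr \<kappa> borel snd) A = emeasure Q A" .
  qed (simp add: Q)
  \<comment> \<open>The total mass of \<kappa> is read off from its first marginal.\<close>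
  have "emeasure (distr \<kappa> borel fst) UNIV = 1"
    unfolding d1 using P.emeasure_space_1 spP by simp
  then have "prob_space \<kappa>"
    using emeasure_distr[OF m\<kappa>(1), of UNIV] by (intro prob_spaceI) simp
  moreover have "sets \<kappa> = sets (borel \<Otimes>\<^sub>M borel)"
    unfolding \<kappa>_def using P(2) Q(2) by (simp cong: sets_pair_measure_cong)
  ultimately have "\<kappa> \<in> couplings P Q" using d1 d2 by (simp add: couplings_def)
  moreover have "0 < \<pi> (F (fst z), F (snd z))" if "0 < w z" for z
    using that \<pi>0[of "(F (fst z), F (snd z))"] by (cases "\<pi> (F (fst z), F (snd z)) = 0") (auto simp: w_def)
  then have "AE z in \<kappa>. 0 < \<pi> (F (fst z), F (snd z))"
    unfolding \<kappa>_def by (subst AE_density[OF w]) auto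
  ultimately show ?thesis by (rule that)
qed

text \<open>The independent plan, with products of cell masses as entries, is feasible.\<close>

lemma product_plan:
  fixes F :: "'a::euclidean_space \<Rightarrow> 'a"
  assumes P: "prob_space P" "sets P = sets borel" and Q: "prob_space Q" "sets Q = sets borel"
    and F: "simple_function borel F"
  shows "plans (range F) (\<lambda>i. measure P (F -` {i})) (\<lambda>j. measure Q (F -` {j})) \<noteq> {}"
proof -
  have total: "(\<Sum>j\<in>range F. measure M (F -` {j})) = 1" if M: "prob_space M" "sets M = sets borel" for M
  proof -
    interpret prob_space M by fact
    have "(\<Union>j\<in>range F. F -` {j}) = space M" using sets_eq_imp_space_eq[OF M(2)] by auto
    then have "1 = measure M (\<Union>j\<in>range F. F -` {j})" using prob_space by simp
    also have "\<dots> = (\<Sum>j\<in>range F. measure M (F -` {j}))"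
      using F simple_functionD(2)[OF F] M(2)
      by (intro finite_measure_finite_Union) (auto simp: simple_function_def disjoint_family_on_def)
    finally show ?thesis by simp
  qed
  have "(\<lambda>z. if z \<in> range F \<times> range F then measure P (F -` {fst z}) * measure Q (F -` {snd z}) else 0)
    \<in> plans (range F) (\<lambda>i. measure P (F -` {i})) (\<lambda>j. measure Q (F -` {j}))"
    unfolding plans_def using total[OF P] total[OF Q]
    by (auto simp: sum_distrib_left[symmetric] sum_distrib_right[symmetric])
  then show ?thesis by blast
qed

section \<open>Quantisation by simple functions\<close>

lemma simple_approximation_of_identity:
  obtains F :: "nat \<Rightarrow> 'a::euclidean_space \<Rightarrow> 'a" where
    "\<And>i. simple_function borel (F i)" "\<And>x. (\<lambda>i. F i x) \<longlonglongrightarrow> x" "\<And>i x. norm (F i x) \<le> 2 * norm x"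
  using borel_measurable_implies_sequence_metric[of "\<lambda>x::'a. x" borel 0] by auto

text \<open>Dominated convergence with majorant \<open>3 * norm x\<close>, which stems from the
  growth bound on \<open>F i\<close>.\<close>

lemma approximation_error:
  fixes F :: "nat \<Rightarrow> 'a::euclidean_space \<Rightarrow> 'a"
  assumes P: "integrable P norm" "sets P = sets borel"
    and F: "\<And>i. F i \<in> borel_measurable borel" "\<And>x. (\<lambda>i. F i x) \<longlonglongrightarrow> x" "\<And>i x. norm (F i x) \<le> 2 * norm x"
  shows "integrable P (\<lambda>x. norm (F i x))" "integrable P (\<lambda>x. norm (x - F i x))"
    "(\<lambda>i. \<integral>x. norm (x - F i x) \<partial>P) \<longlonglongrightarrow> 0"
proof -
  have [measurable]: "F i \<in> borel_measurable P" "(\<lambda>x. x) \<in> borel_measurable P" for i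
    using F(1) by (simp_all cong: measurable_cong_sets add: P)
  have le: "norm (x - F i x) \<le> 3 * norm x" for i x
    using norm_triangle_ineq4[of x "F i x"] F(3)[of i x] by linarith
  show "integrable P (\<lambda>x. norm (F i x))"
    by (rule Bochner_Integration.integrable_bound[of _ "\<lambda>x. 2 * norm x"]) (use P F(3) in auto)
  show "integrable P (\<lambda>x. norm (x - F i x))"
    by (rule Bochner_Integration.integrable_bound[of _ "\<lambda>x. 3 * norm x"]) (use P le in auto)
  have "(\<lambda>i. \<integral>x. norm (x - F i x) \<partial>P) \<longlonglongrightarrow> (\<integral>x. 0 \<partial>P)"
  proof (rule integral_dominated_convergence)
    show "integrable P (\<lambda>x. 3 * norm x)" using P by simp
    have "(\<lambda>i. norm (x - F i x)) \<longlonglongrightarrow> norm (x - x)" for x by (intro tendsto_intros F)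
    then show "AE x in P. (\<lambda>i. norm (x - F i x)) \<longlonglongrightarrow> 0" by simp
  qed (use le in auto)
  then show "(\<lambda>i. \<integral>x. norm (x - F i x) \<partial>P) \<longlonglongrightarrow> 0" by simp
qed

section \<open>Duality for Lipschitz costs with the triangle inequality\<close>

text \<open>The cost may be asymmetric and may take negative values, as the compensated cost does
  where compensation prevails.\<close>

locale lipschitz_cost =
  fixes c :: "real ^ 'd \<Rightarrow> real ^ 'd \<Rightarrow> real" and L :: real
  assumes tri: "c x z \<le> c x y + c y z" and bound: "\<bar>c x y\<bar> \<le> L * norm (x - y)"
begin

lemma diag: "c x x = 0" using bound[of x x] by simp

lemma L_nonneg: "0 \<le> L"
proof -
  have "\<bar>c (axis i 1) 0\<bar> \<le> L" for i using bound[of "axis i 1" 0] by simp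
  then show ?thesis using abs_ge_zero order_trans by blast
qed

text \<open>Passing through \<open>x'\<close> and \<open>y'\<close> gives
  \<open>c x y \<le> c x x' + c x' y' + c y' y\<close>, and likewise with the two pairs exchanged;
  the outer terms are bounded by distances.\<close>

lemma lipschitz: "\<bar>c x y - c x' y'\<bar> \<le> L * (norm (x - x') + norm (y - y'))"
proof -
  have le: "c a b \<le> L * norm (a - b)" "c a b \<le> L * norm (b - a)" for a b
    using bound[of a b] by (simp_all add: norm_minus_commute abs_le_iff)
  show ?thesis
    using tri[of x y x'] tri[of x' y y'] tri[of x' y' x] tri[of x y' y]
      le(1)[of x x'] le(2)[of x' x] le(1)[of y y'] le(2)[of y' y]
    unfolding distrib_left by linarith
qed

lemma continuous: "continuous_on UNIV (\<lambda>z. c (fst z) (snd z))"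
proof (rule lipschitz_on_continuous_on, rule lipschitz_onI)
  show "0 \<le> 2 * L" using L_nonneg by simp
  show "dist (c (fst z) (snd z)) (c (fst w) (snd w)) \<le> (2 * L) * dist z w" for z w
    using lipschitz[of "fst z" "snd z" "fst w" "snd w"] L_nonneg
      mult_left_mono[OF dist_fst_le[of z w] L_nonneg] mult_left_mono[OF dist_snd_le[of z w] L_nonneg]
    by (simp add: dist_norm algebra_simps)
qed

lemma measurable_cost: "(\<lambda>z. c (fst z) (snd z)) \<in> borel_measurable borel"
  by (rule borel_measurable_continuous_onI[OF continuous])


lemma integrable_cost:
  assumes \<kappa>: "\<kappa> \<in> couplings P Q" and P: "integrable P norm" and Q: "integrable Q norm"
  shows "integrable \<kappa> (\<lambda>z. c (fst z) (snd z))"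
proof (rule Bochner_Integration.integrable_bound)
  note k = couplingsD[OF \<kappa>]
  have "integrable \<kappa> (\<lambda>z. norm (fst z))" "integrable \<kappa> (\<lambda>z. norm (snd z))"
    using P Q k by (auto intro: integrable_distr)
  then show "integrable \<kappa> (\<lambda>z. L * (norm (fst z) + norm (snd z)))" by simp
  show "(\<lambda>z. c (fst z) (snd z)) \<in> borel_measurable \<kappa>"
    using measurable_cost by (simp cong: measurable_cong_sets add: k)
  have "norm (c x y) \<le> norm (L * (norm x + norm y))" for x y
  proof -
    have "\<bar>c x y\<bar> \<le> L * norm (x - y)" by (rule bound)
    also have "\<dots> \<le> L * (norm x + norm y)" by (intro mult_left_mono norm_triangle_ineq4 L_nonneg)
    finally show ?thesis by simp
  qed
  then show "AE z in \<kappa>. norm (c (fst z) (snd z)) \<le> norm (L * (norm (fst z) + norm (snd z)))" by simp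
qed

text \<open>The Lipschitz estimate is integrated. The cost of \<open>(X, Y)\<close> is integrable as
  the sum of the cost of \<open>(X', Y')\<close> and an integrable difference.\<close>

lemma integral_perturbed_cost:
  fixes M :: "'z measure" and X Y X' Y' :: "'z \<Rightarrow> real ^ 'd"
  assumes m: "X \<in> borel_measurable M" "Y \<in> borel_measurable M" "X' \<in> borel_measurable M" "Y' \<in> borel_measurable M"
    and i: "integrable M (\<lambda>z. norm (X' z))" "integrable M (\<lambda>z. norm (Y' z))"
      "integrable M (\<lambda>z. norm (X z - X' z))" "integrable M (\<lambda>z. norm (Y z - Y' z))"
  shows "integrable M (\<lambda>z. c (X' z) (Y' z))" "integrable M (\<lambda>z. c (X z) (Y z))"
    "\<bar>(\<integral>z. c (X z) (Y z) \<partial>M) - (\<integral>z. c (X' z) (Y' z) \<partial>M)\<bar>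
      \<le> L * ((\<integral>z. norm (X z - X' z) \<partial>M) + (\<integral>z. norm (Y z - Y' z) \<partial>M))"
proof -
  have meas: "(\<lambda>z. c (f z) (g z)) \<in> borel_measurable M"
    if "f \<in> borel_measurable M" "g \<in> borel_measurable M" for f g
    using measurable_compose[OF borel_measurable_Pair[OF that] measurable_cost] by simp
  have le: "\<bar>c x y\<bar> \<le> L * (norm x + norm y)" for x y
    using bound[of x y] mult_left_mono[OF norm_triangle_ineq4[of x y] L_nonneg] by linarith
  show 1: "integrable M (\<lambda>z. c (X' z) (Y' z))"
    by (rule Bochner_Integration.integrable_bound[of _ "\<lambda>z. L * (norm (X' z) + norm (Y' z))"])
      (use i meas m le in \<open>auto simp: L_nonneg\<close>)
  let ?d = "\<lambda>z. c (X z) (Y z) - c (X' z) (Y' z)"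
  have d: "integrable M ?d"
    by (rule Bochner_Integration.integrable_bound[of _ "\<lambda>z. L * (norm (X z - X' z) + norm (Y z - Y' z))"])
      (use i meas m lipschitz in \<open>auto simp: L_nonneg\<close>)
  show 2: "integrable M (\<lambda>z. c (X z) (Y z))"
    using Bochner_Integration.integrable_add[OF d 1] by simp
  have "\<bar>\<integral>z. ?d z \<partial>M\<bar> \<le> (\<integral>z. \<bar>?d z\<bar> \<partial>M)" by (rule integral_abs_bound)
  also have "\<dots> \<le> (\<integral>z. L * (norm (X z - X' z) + norm (Y z - Y' z)) \<partial>M)"
    using d i lipschitz by (intro integral_mono) auto
  finally show "\<bar>(\<integral>z. c (X z) (Y z) \<partial>M) - (\<integral>z. c (X' z) (Y' z) \<partial>M)\<bar>
      \<le> L * ((\<integral>z. norm (X z - X' z) \<partial>M) + (\<integral>z. norm (Y z - Y' z) \<partial>M))"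
    using 1 2 i by simp
qed

text \<open>The quantisation error involves the marginals only, so the bound is uniform over all
  couplings.\<close>

lemma coupling_discretized_cost:
  assumes \<kappa>: "\<kappa> \<in> couplings P Q" and F: "F \<in> borel_measurable borel"
    and i: "integrable P (\<lambda>x. norm (F x))" "integrable Q (\<lambda>x. norm (F x))"
      "integrable P (\<lambda>x. norm (x - F x))" "integrable Q (\<lambda>x. norm (x - F x))"
  shows "\<bar>(\<integral>z. c (fst z) (snd z) \<partial>\<kappa>) - (\<integral>z. c (F (fst z)) (F (snd z)) \<partial>\<kappa>)\<bar>
    \<le> L * ((\<integral>x. norm (x - F x) \<partial>P) + (\<integral>x. norm (x - F x) \<partial>Q))"
proof -
  note k = couplingsD[OF \<kappa>]
  have int: "integrable \<kappa> (\<lambda>z. f (fst z))" "integrable \<kappa> (\<lambda>z. g (snd z))"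
    if "integrable P f" "integrable Q g" for f g :: "real ^ 'd \<Rightarrow> real"
    using that k by (auto intro: integrable_distr)
  have "(\<integral>z. f (fst z) \<partial>\<kappa>) = (\<integral>x. f x \<partial>P)" "(\<integral>z. f (snd z) \<partial>\<kappa>) = (\<integral>x. f x \<partial>Q)"
    if "f \<in> borel_measurable borel" for f :: "real ^ 'd \<Rightarrow> real"
    using integral_distr[OF k(6) that] integral_distr[OF k(7) that] by (simp_all add: k)
  moreover have "(\<lambda>x. norm (x - F x)) \<in> borel_measurable borel" using F by measurable
  ultimately have "(\<integral>z. norm (fst z - F (fst z)) \<partial>\<kappa>) = (\<integral>x. norm (x - F x) \<partial>P)"
    "(\<integral>z. norm (snd z - F (snd z)) \<partial>\<kappa>) = (\<integral>x. norm (x - F x) \<partial>Q)" by blast+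
  moreover have "(\<lambda>z. F (fst z)) \<in> borel_measurable \<kappa>" "(\<lambda>z. F (snd z)) \<in> borel_measurable \<kappa>"
    using measurable_compose[OF k(6) F] measurable_compose[OF k(7) F] by auto
  ultimately show ?thesis
    using integral_perturbed_cost(3)[of fst \<kappa> snd "\<lambda>z. F (fst z)" "\<lambda>z. F (snd z)"] k int[OF i(1,2)] int[OF i(3,4)]
    by simp
qed

text \<open>This is the compactness step. Quantised pairs have limit laws along a subsequence,
  joined in a law \<mu> on sequences; the coupling sought is the law of the limit of the sequence
  under \<mu>.\<close>

lemma limit_coupling:
  assumes K: "\<And>n. K n \<in> couplings P Q" and P: "integrable P norm" and Q: "integrable Q norm"
    and cost: "\<And>n. (\<integral>z. c (fst z) (snd z) \<partial>K n) \<le> V + e n" and e: "e \<longlonglongrightarrow> 0"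
  shows "\<exists>\<kappa>\<in>couplings P Q. (\<integral>z. c (fst z) (snd z) \<partial>\<kappa>) \<le> V"
proof -
  note k = couplingsD[OF K]
  obtain F :: "nat \<Rightarrow> real ^ 'd \<Rightarrow> real ^ 'd" where simple: "\<And>i. simple_function borel (F i)"
    and F_lim: "\<And>x. (\<lambda>i. F i x) \<longlonglongrightarrow> x" and F_le: "\<And>i x. norm (F i x) \<le> 2 * norm x"
    by (rule simple_approximation_of_identity) blast
  have F: "F i \<in> borel_measurable borel" for i using simple by (rule borel_measurable_simple_function)
  have sets: "sets P = sets borel" "sets Q = sets borel"
    using k(4)[of 0, THEN arg_cong[where f = sets]] k(5)[of 0, THEN arg_cong[where f = sets]] by simp_all
  note errP = approximation_error[OF P sets(1) F F_lim F_le]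
  note errQ = approximation_error[OF Q sets(2) F F_lim F_le]
  define err where "err i = L * ((\<integral>x. norm (x - F i x) \<partial>P) + (\<integral>x. norm (x - F i x) \<partial>Q))" for i
  have err: "err \<longlonglongrightarrow> 0"
    unfolding err_def using tendsto_mult[OF tendsto_const tendsto_add[OF errP(3) errQ(3)], of L] by simp
  define G where "G i z = (F i (fst z), F i (snd z))" for i :: nat and z :: "(real ^ 'd) \<times> (real ^ 'd)"
  have F_range: "finite (range (F i))" for i using simple[of i] by (simp add: simple_function_def)
  have mfst: "fst \<in> borel_measurable (borel :: ((real ^ 'd) \<times> (real ^ 'd)) measure)"
    and msnd: "snd \<in> borel_measurable (borel :: ((real ^ 'd) \<times> (real ^ 'd)) measure)"
    by (simp_all add: borel_measurable_continuous_onI continuous_on_fst continuous_on_snd)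
  have G: "G i \<in> borel_measurable borel" for i
    unfolding G_def[abs_def]
    using measurable_compose[OF mfst F] measurable_compose[OF msnd F] by (rule borel_measurable_Pair)
  have G_range: "finite (range (G i))" for i
    by (rule finite_subset[of _ "range (F i) \<times> range (F i)"]) (auto simp: G_def F_range)
  have sG: "simple_function borel (G i)" for i
    using G G_range by (intro simple_function_borel_measurable) auto
  obtain \<mu> r where \<mu>: "prob_space \<mu>" "sets \<mu> = sets (PiM UNIV (\<lambda>_. borel))" and r: "strict_mono r"
    and conv: "\<And>J X. finite J \<Longrightarrow> X \<in> sets (PiM J (\<lambda>_. borel)) \<Longrightarrow>
      (\<lambda>n. measure (K (r n)) {z\<in>space borel. (\<lambda>i\<in>J. G i z) \<in> X}) \<longlonglongrightarrow> measure \<mu> {h. restrict h J \<in> X}"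
    by (rule kolmogorov_limit_law[where K = K and G = G, OF k(1) k(2) sG]) blast
  have conv: "(\<lambda>n. measure (K (r n)) {z. (\<lambda>i\<in>J. G i z) \<in> X}) \<longlonglongrightarrow> measure \<mu> {h. restrict h J \<in> X}"
    if "finite J" "X \<in> sets (PiM J (\<lambda>_. borel))" for J X
    using conv[OF that] by simp
  interpret \<mu>: prob_space \<mu> by fact
  have sp\<mu>: "space \<mu> = UNIV" using sets_eq_imp_space_eq[OF \<mu>(2)] by (simp add: space_PiM)
  let ?N = "PiM UNIV (\<lambda>_::nat. borel :: (real ^ 'd) measure)"
  have comp: "(\<lambda>h. h i) \<in> borel_measurable \<mu>" for i
  proof -
    have "(\<lambda>h. h i) \<in> borel_measurable (PiM UNIV (\<lambda>_::nat. borel :: ((real ^ 'd) \<times> (real ^ 'd)) measure))" by measurable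
    then show ?thesis by (simp cong: measurable_cong_sets add: \<mu>)
  qed
  note comp_fst = measurable_compose[OF comp mfst] and comp_snd = measurable_compose[OF comp msnd]
  have fG: "fst (G i z) = F i (fst z)" "snd (G i z) = F i (snd z)" for i z by (simp_all add: G_def)
  have marg: "distr \<mu> ?N (\<lambda>h i. fst (h i)) = distr P ?N (\<lambda>x i. F i x)"
    "distr \<mu> ?N (\<lambda>h i. snd (h i)) = distr Q ?N (\<lambda>x i. F i x)"
    by (rule limit_law_marginal[where K = "\<lambda>n. K (r n)" and G = G and F = F, OF \<mu> conv k(1) k(2) k(4) mfst F fG(1)],
        assumption+,
        rule limit_law_marginal[where K = "\<lambda>n. K (r n)" and G = G and F = F, OF \<mu> conv k(1) k(2) k(5) msnd F fG(2)])
  have mN: "(\<lambda>h i. fst (h i)) \<in> measurable \<mu> ?N" "(\<lambda>h i. snd (h i)) \<in> measurable \<mu> ?N"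
    "(\<lambda>x i. F i x) \<in> measurable P ?N" "(\<lambda>x i. F i x) \<in> measurable Q ?N"
    using comp_fst comp_snd F by (auto intro!: measurable_PiM_single' cong: measurable_cong_sets simp: sets)
  \<comment> \<open>Any measurable functional of one coordinate sequence can be integrated under the
    fixed marginal, with \<open>F i x\<close> in place of the coordinates.\<close>
  have int: "integrable \<mu> (\<lambda>h. \<psi> (\<lambda>i. fst (h i))) = integrable P (\<lambda>x. \<psi> (\<lambda>i. F i x))"
    "integrable \<mu> (\<lambda>h. \<psi> (\<lambda>i. snd (h i))) = integrable Q (\<lambda>x. \<psi> (\<lambda>i. F i x))"
    "(\<integral>h. \<psi> (\<lambda>i. fst (h i)) \<partial>\<mu>) = (\<integral>x. \<psi> (\<lambda>i. F i x) \<partial>P)"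
    "(\<integral>h. \<psi> (\<lambda>i. snd (h i)) \<partial>\<mu>) = (\<integral>x. \<psi> (\<lambda>i. F i x) \<partial>Q)"
    if "\<psi> \<in> borel_measurable ?N" for \<psi> :: "(nat \<Rightarrow> real ^ 'd) \<Rightarrow> real"
    using integrable_distr_eq[OF mN(1) that] integrable_distr_eq[OF mN(2) that]
      integrable_distr_eq[OF mN(3) that] integrable_distr_eq[OF mN(4) that]
      integral_distr[OF mN(1) that] integral_distr[OF mN(2) that]
      integral_distr[OF mN(3) that] integral_distr[OF mN(4) that]
    unfolding marg by simp_all
  define X where "X h = lim (\<lambda>i. fst (h i))" for h :: "nat \<Rightarrow> (real ^ 'd) \<times> (real ^ 'd)"
  define Y where "Y h = lim (\<lambda>i. snd (h i))" for h :: "nat \<Rightarrow> (real ^ 'd) \<times> (real ^ 'd)"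
  have XY: "X \<in> borel_measurable \<mu>" "Y \<in> borel_measurable \<mu>"
    unfolding X_def[abs_def] Y_def[abs_def] using comp_fst comp_snd by (auto intro: borel_measurable_lim_metric)
  \<comment> \<open>As \<open>lim\<close> is a measurable functional on sequences, the laws of
    \<open>X\<close> and \<open>Y\<close> depend only on the laws of the coordinate sequences. On
    the sequence \<open>F i x\<close> it returns \<open>x\<close>, so these laws are
    \<open>P\<close> and \<open>Q\<close>.\<close>
  have limN: "lim \<in> borel_measurable ?N"
    using borel_measurable_lim_metric[of "\<lambda>i h. h i" ?N] by simp
  have limF: "lim (\<lambda>i. F i x) = x" for x using F_lim by (rule limI)
  have dX: "distr \<mu> borel X = P"
    using distr_distr[OF limN mN(1)] distr_distr[OF limN mN(3)] marg(1) sets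
    by (simp add: o_def limF X_def[abs_def] distr_id2)
  have dY: "distr \<mu> borel Y = Q"
    using distr_distr[OF limN mN(2)] distr_distr[OF limN mN(4)] marg(2) sets
    by (simp add: o_def limF Y_def[abs_def] distr_id2)
  define \<kappa> where "\<kappa> = distr \<mu> borel (\<lambda>h. (X h, Y h))"
  have mXY: "(\<lambda>h. (X h, Y h)) \<in> borel_measurable \<mu>" using XY by (rule borel_measurable_Pair)
  have \<kappa>: "\<kappa> \<in> couplings P Q"
    unfolding couplings_def
  proof (intro CollectI conjI)
    show "prob_space \<kappa>" unfolding \<kappa>_def by (rule \<mu>.prob_space_distr[OF mXY])
    show "sets \<kappa> = sets (borel \<Otimes>\<^sub>M borel)" unfolding \<kappa>_def borel_prod by simp
    show "distr \<kappa> borel fst = P" "distr \<kappa> borel snd = Q"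
      unfolding \<kappa>_def using dX dY by (simp_all add: distr_distr[OF mfst mXY] distr_distr[OF msnd mXY] o_def)
  qed
  \<comment> \<open>At a fixed level the cost is a finite sum of point probabilities, so the
    quantised cost under \<open>K (r n)\<close> converges to the one under \<mu>, while it stays
    below \<open>V + e (r n) + err i\<close>.\<close>
  have level: "(\<integral>h. c (fst (h i)) (snd (h i)) \<partial>\<mu>) \<le> V + err i" for i
  proof -
    let ?R = "range (G i)" and ?c = "\<lambda>z. c (fst z) (snd z)"
    have R_borel: "A \<in> sets borel" if "A \<subseteq> ?R" for A
      using finite_subset[OF that G_range] by (intro borel_closed finite_imp_closed)
    have one: "(\<lambda>n. measure (K (r n)) {z. G i z \<in> A}) \<longlonglongrightarrow> measure \<mu> {h. h i \<in> A}" if "A \<subseteq> ?R" for A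
    proof -
      have "PiE {i} (\<lambda>_. A) \<in> sets (PiM {i} (\<lambda>_. borel))"
        using R_borel[OF that] by (intro sets_PiM_I_finite) auto
      from conv[OF _ this] show ?thesis by simp
    qed
    \<comment> \<open>The finite range of \<open>G i\<close> has probability one for every
      \<open>n\<close>, hence also in the limit.\<close>
    have "(\<lambda>n. measure (K (r n)) {z. G i z \<in> ?R}) \<longlonglongrightarrow> 1"
      using prob_space.prob_space[OF k(1)] by (simp add: k(3))
    with one[of ?R] have "measure \<mu> {h. h i \<in> ?R} = 1" by (simp add: LIMSEQ_unique)
    then have AE: "AE h in \<mu>. h i \<in> ?R"
      using \<mu>.AE_in_set_eq_1[of "{h. h i \<in> ?R}"] measurable_sets[OF comp R_borel[of ?R], of i]
      by (simp add: sp\<mu> vimage_def)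
    have "(\<integral>h. ?c (h i) \<partial>\<mu>) = (\<Sum>a\<in>?R. ?c a * measure \<mu> {h. h i = a})"
      using finite_range_expectation[OF \<mu>(1) measurable_cost comp G_range AE] by (simp add: sp\<mu>)
    moreover have "(\<integral>z. ?c (G i z) \<partial>K n) = (\<Sum>a\<in>?R. ?c a * measure (K n) {z. G i z = a})" for n
    proof -
      have "G i \<in> borel_measurable (K n)" using G by (simp cong: measurable_cong_sets add: k)
      from finite_range_expectation[OF k(1) measurable_cost this G_range] show ?thesis by (simp add: k(3))
    qed
    moreover have "(\<lambda>n. \<Sum>a\<in>?R. ?c a * measure (K (r n)) {z. G i z = a})
        \<longlonglongrightarrow> (\<Sum>a\<in>?R. ?c a * measure \<mu> {h. h i = a})"
    proof (intro tendsto_sum tendsto_mult tendsto_const)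
      show "(\<lambda>n. measure (K (r n)) {z. G i z = a}) \<longlonglongrightarrow> measure \<mu> {h. h i = a}" if "a \<in> ?R" for a
        using one[of "{a}"] that by simp
    qed
    ultimately have "(\<lambda>n. \<integral>z. ?c (G i z) \<partial>K (r n)) \<longlonglongrightarrow> (\<integral>h. ?c (h i) \<partial>\<mu>)" by simp
    moreover have "(\<lambda>n. V + e (r n) + err i) \<longlonglongrightarrow> V + 0 + err i"
      using LIMSEQ_subseq_LIMSEQ[OF e r] by (intro tendsto_intros) (simp add: o_def)
    moreover have "(\<integral>z. ?c (G i z) \<partial>K n) \<le> V + e n + err i" for n
      using coupling_discretized_cost[OF K F errP(1) errQ(1) errP(2) errQ(2), of n i] cost[of n]
      unfolding err_def G_def by simp
    ultimately show ?thesis by (auto intro: LIMSEQ_le)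
  qed
  \<comment> \<open>One \<open>err i\<close> comes from quantising under the couplings, the other
    from replacing the limits \<open>X\<close> and \<open>Y\<close> by the coordinates at level
    \<open>i\<close>.\<close>
  have "(\<integral>z. c (fst z) (snd z) \<partial>\<kappa>) \<le> V + 2 * err i" for i
  proof -
    have m1: "(\<lambda>g. norm (g i)) \<in> borel_measurable ?N" by measurable
    have m2: "(\<lambda>g. norm (lim g - g i)) \<in> borel_measurable ?N" using limN by measurable
    have "(\<integral>z. c (fst z) (snd z) \<partial>\<kappa>) = (\<integral>h. c (X h) (Y h) \<partial>\<mu>)"
      unfolding \<kappa>_def by (simp add: integral_distr[OF mXY measurable_cost])
    also have "\<dots> \<le> (\<integral>h. c (fst (h i)) (snd (h i)) \<partial>\<mu>) + err i"
      using integral_perturbed_cost(3)[OF XY comp_fst comp_snd, of i i]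
        int[OF m1] int[OF m2] errP(1,2)[of i] errQ(1,2)[of i]
      unfolding err_def by (simp add: limF X_def[symmetric] Y_def[symmetric])
    also have "\<dots> \<le> V + 2 * err i" using level[of i] by simp
    finally show ?thesis .
  qed
  moreover have "(\<lambda>i. V + 2 * err i) \<longlonglongrightarrow> V + 2 * 0" by (intro tendsto_intros err)
  ultimately have "(\<integral>z. c (fst z) (snd z) \<partial>\<kappa>) \<le> V" by (auto intro: LIMSEQ_le_const)
  with \<kappa> show ?thesis by blast
qed

section \<open>Potentials, near-optimal couplings and attainment\<close>

lemma potential_regular:
  assumes u: "\<And>x y. u x - u y \<le> c x y"
  shows "\<bar>u x - u y\<bar> \<le> L * norm (x - y)" "u \<in> borel_measurable borel"
    "sets P = sets borel \<Longrightarrow> prob_space P \<Longrightarrow> integrable P norm \<Longrightarrow> integrable P u"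
proof -
  \<comment> \<open>The constraint is used for \<open>(x, y)\<close> and for \<open>(y, x)\<close>;
    continuity and linear growth, hence integrability, follow.\<close>
  show lip: "\<bar>u x - u y\<bar> \<le> L * norm (x - y)" for x y
    using u[of x y] u[of y x] bound[of x y] bound[of y x] by (simp add: norm_minus_commute abs_le_iff)
  have "continuous_on UNIV u"
    by (rule lipschitz_on_continuous_on[of L], rule lipschitz_onI) (auto simp: dist_norm lip L_nonneg)
  then show m: "u \<in> borel_measurable borel" by (rule borel_measurable_continuous_onI)
  assume P: "sets P = sets borel" "prob_space P" "integrable P norm"
  interpret prob_space P by fact
  show "integrable P u"
  proof (rule Bochner_Integration.integrable_bound)
    show "integrable P (\<lambda>x. \<bar>u 0\<bar> + L * norm x)" using P by simp
    show "u \<in> borel_measurable P" using m by (simp cong: measurable_cong_sets add: P)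
    have "\<bar>u x\<bar> \<le> \<bar>u 0\<bar> + L * norm x" for x using lip[of x 0] by simp
    then show "AE x in P. norm (u x) \<le> norm (\<bar>u 0\<bar> + L * norm x)" using L_nonneg by simp
  qed
qed

text \<open>An optimal plan of the quantised problem is spread over the cells, and its tight
  potential is compared with the bound \<open>V\<close>. The factor 2 collects the error of
  quantising the cost and that of replacing \<open>u (F x)\<close> by \<open>u x\<close> under both
  marginals.\<close>

lemma near_optimal_coupling:
  assumes P: "prob_space P" "sets P = sets borel" "integrable P norm"
    and Q: "prob_space Q" "sets Q = sets borel" "integrable Q norm"
    and V: "\<And>u. (\<And>x y. u x - u y \<le> c x y) \<Longrightarrow> (\<integral>x. u x \<partial>P) - (\<integral>x. u x \<partial>Q) \<le> V"
    and F: "simple_function borel F" and iF: "integrable P (\<lambda>x. norm (F x))" "integrable Q (\<lambda>x. norm (F x))"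
      "integrable P (\<lambda>x. norm (x - F x))" "integrable Q (\<lambda>x. norm (x - F x))"
  shows "\<exists>\<kappa>\<in>couplings P Q. (\<integral>z. c (fst z) (snd z) \<partial>\<kappa>)
    \<le> V + 2 * (L * ((\<integral>x. norm (x - F x) \<partial>P) + (\<integral>x. norm (x - F x) \<partial>Q)))"
proof -
  have fin: "finite (range F)" using F by (simp add: simple_function_def)
  have mF: "F \<in> borel_measurable borel" by (rule borel_measurable_simple_function[OF F])
  obtain \<pi> where \<pi>: "\<pi> \<in> plans (range F) (\<lambda>i. measure P (F -` {i})) (\<lambda>j. measure Q (F -` {j}))"
    and opt: "\<And>\<rho>. \<rho> \<in> plans (range F) (\<lambda>i. measure P (F -` {i})) (\<lambda>j. measure Q (F -` {j})) \<Longrightarrow>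
      (\<Sum>z\<in>range F\<times>range F. \<pi> z * c (fst z) (snd z)) \<le> (\<Sum>z\<in>range F\<times>range F. \<rho> z * c (fst z) (snd z))"
    by (rule optimal_plan_exists[OF fin product_plan[OF P(1,2) Q(1,2) F], where f = "\<lambda>z. c (fst z) (snd z)"]) blast
  obtain \<kappa> where \<kappa>: "\<kappa> \<in> couplings P Q" and supp: "AE z in \<kappa>. 0 < \<pi> (F (fst z), F (snd z))"
    by (rule glue_plan[OF P(1,2) Q(1,2) F \<pi>])
  interpret \<kappa>: prob_space \<kappa> by (rule couplingsD(1)[OF \<kappa>])
  \<comment> \<open>A probability measure cannot live on the empty set, so the plan charges some
    pair, which serves as the base point of the chains.\<close>
  have "\<exists>z. 0 < \<pi> (F (fst z), F (snd z))"
  proof (rule ccontr)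
    assume "\<not> ?thesis"
    with supp have "AE z in \<kappa>. False" by simp
    then show False by simp
  qed
  then obtain x0 y0 where x0: "0 < \<pi> (x0, y0)" "x0 \<in> range F" by blast
  have S: "{z. 0 < \<pi> z} \<subseteq> range F \<times> range F"
    using \<pi> unfolding plans_def by (metis (mono_tags, lifting) less_irrefl mem_Collect_eq subsetI)
  obtain u where u: "\<And>x y. u x - u y \<le> c x y" and tight: "\<And>x y. (x, y) \<in> {z. 0 < \<pi> z} \<Longrightarrow> u x - u y = c x y"
  proof (rule tight_potential[OF tri diag S])
    show "(x0, y0) \<in> {z. 0 < \<pi> z}" using x0 by simp
    show "0 \<le> r" if "alt_chain c {z. 0 < \<pi> z} (range F) x0 x0 r" for r
      by (rule optimal_plan_closed_chain[OF fin \<pi> opt that x0(2)])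
  qed blast
  note ru = potential_regular[of u, OF u]
  have mu: "(\<lambda>x. u (F x)) \<in> borel_measurable borel" using measurable_compose[OF mF ru(2)] .
  have iu: "integrable M (\<lambda>x. u (F x))" "\<bar>(\<integral>x. u (F x) \<partial>M) - (\<integral>x. u x \<partial>M)\<bar> \<le> L * (\<integral>x. norm (x - F x) \<partial>M)"
    if M: "prob_space M" "sets M = sets borel" "integrable M norm" and i: "integrable M (\<lambda>x. norm (x - F x))" for M
  proof -
    have [measurable]: "u \<in> borel_measurable M" "(\<lambda>x. u (F x)) \<in> borel_measurable M"
      using ru(2) mu by (simp_all cong: measurable_cong_sets add: M)
    have le: "\<bar>u (F x) - u x\<bar> \<le> L * norm (x - F x)" for x
      using ru(1)[of "F x" x] by (simp add: norm_minus_commute)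
    have d: "integrable M (\<lambda>x. u (F x) - u x)"
      by (rule Bochner_Integration.integrable_bound[of _ "\<lambda>x. L * norm (x - F x)"])
        (use i le in \<open>auto simp: L_nonneg\<close>)
    have iu: "integrable M u" by (rule ru(3)[OF M(2,1,3)])
    show iuF: "integrable M (\<lambda>x. u (F x))" using Bochner_Integration.integrable_add[OF d iu] by simp
    have "\<bar>(\<integral>x. u (F x) - u x \<partial>M)\<bar> \<le> (\<integral>x. \<bar>u (F x) - u x\<bar> \<partial>M)" by (rule integral_abs_bound)
    also have "\<dots> \<le> (\<integral>x. L * norm (x - F x) \<partial>M)" using d i le by (intro integral_mono) auto
    finally show "\<bar>(\<integral>x. u (F x) \<partial>M) - (\<integral>x. u x \<partial>M)\<bar> \<le> L * (\<integral>x. norm (x - F x) \<partial>M)"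
      using iu iuF by simp
  qed
  note uP = iu[OF P iF(3)] and uQ = iu[OF Q iF(4)]
  \<comment> \<open>Almost surely under \<kappa> the quantised pair lies in the support of the plan,
    where the potential is tight.\<close>
  have "(\<integral>z. c (F (fst z)) (F (snd z)) \<partial>\<kappa>) = (\<integral>z. u (F (fst z)) - u (F (snd z)) \<partial>\<kappa>)"
  proof (rule integral_cong_AE)
    note k = couplingsD[OF \<kappa>]
    show "(\<lambda>z. c (F (fst z)) (F (snd z))) \<in> borel_measurable \<kappa>"
      using measurable_compose[OF borel_measurable_Pair[OF measurable_compose[OF k(6) mF] measurable_compose[OF k(7) mF]] measurable_cost]
      by simp
    show "(\<lambda>z. u (F (fst z)) - u (F (snd z))) \<in> borel_measurable \<kappa>"
      using measurable_compose[OF k(6) mu] measurable_compose[OF k(7) mu] by (rule borel_measurable_diff)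
    show "AE z in \<kappa>. c (F (fst z)) (F (snd z)) = u (F (fst z)) - u (F (snd z))"
      using supp by eventually_elim (simp add: tight)
  qed
  also have "\<dots> = (\<integral>x. u (F x) \<partial>P) - (\<integral>x. u (F x) \<partial>Q)"
    by (rule coupling_integral_diff(2)[OF \<kappa> mu uP(1) uQ(1)])
  finally have "(\<integral>z. c (fst z) (snd z) \<partial>\<kappa>)
    \<le> V + 2 * (L * ((\<integral>x. norm (x - F x) \<partial>P) + (\<integral>x. norm (x - F x) \<partial>Q)))"
    using uP(2) uQ(2) V[of u, OF u] coupling_discretized_cost[OF \<kappa> mF iF]
    unfolding distrib_left by linarith
  with \<kappa> show ?thesis by blast
qed

text \<open>With an arbitrary upper bound \<open>V\<close> of the dual values, this contains strong
  duality and attainment at once: near-optimal couplings with vanishing excess are passed to the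
  limit.\<close>

lemma optimal_coupling_duality:
  assumes P: "prob_space P" "sets P = sets borel" "integrable P norm"
    and Q: "prob_space Q" "sets Q = sets borel" "integrable Q norm"
    and V: "\<And>u. (\<And>x y. u x - u y \<le> c x y) \<Longrightarrow> (\<integral>x. u x \<partial>P) - (\<integral>x. u x \<partial>Q) \<le> V"
  shows "\<exists>\<kappa>\<in>couplings P Q. (\<integral>z. c (fst z) (snd z) \<partial>\<kappa>) \<le> V"
proof -
  obtain F :: "nat \<Rightarrow> real ^ 'd \<Rightarrow> real ^ 'd" where simple: "\<And>i. simple_function borel (F i)"
    and F_lim: "\<And>x. (\<lambda>i. F i x) \<longlonglongrightarrow> x" and F_le: "\<And>i x. norm (F i x) \<le> 2 * norm x"
    by (rule simple_approximation_of_identity) blast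
  have F: "F i \<in> borel_measurable borel" for i using simple by (rule borel_measurable_simple_function)
  note errP = approximation_error[OF P(3,2) F F_lim F_le]
  note errQ = approximation_error[OF Q(3,2) F F_lim F_le]
  define err where "err i = 2 * (L * ((\<integral>x. norm (x - F i x) \<partial>P) + (\<integral>x. norm (x - F i x) \<partial>Q)))" for i
  have "err \<longlonglongrightarrow> 2 * (L * (0 + 0))"
    unfolding err_def by (intro tendsto_intros errP(3) errQ(3))
  then have err: "err \<longlonglongrightarrow> 0" by simp
  have "\<forall>n. \<exists>\<kappa>\<in>couplings P Q. (\<integral>z. c (fst z) (snd z) \<partial>\<kappa>) \<le> V + err n"
    unfolding err_def
    by (intro allI near_optimal_coupling[OF P Q V simple errP(1) errQ(1) errP(2) errQ(2)])
  then obtain K where "\<And>n. K n \<in> couplings P Q" "\<And>n. (\<integral>z. c (fst z) (snd z) \<partial>K n) \<le> V + err n" by metis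
  from limit_coupling[where K = K, OF this(1) P(3) Q(3) this(2) err] show ?thesis .
qed

lemma weak_duality:
  assumes P: "prob_space P" "sets P = sets borel" "integrable P norm"
    and Q: "prob_space Q" "sets Q = sets borel" "integrable Q norm"
    and u: "\<And>x y. u x - u y \<le> c x y" and \<kappa>: "\<kappa> \<in> couplings P Q"
  shows "(\<integral>x. u x \<partial>P) - (\<integral>x. u x \<partial>Q) \<le> (\<integral>z. c (fst z) (snd z) \<partial>\<kappa>)"
proof -
  note ru = potential_regular[of u, OF u]
  note d = coupling_integral_diff[OF \<kappa> ru(2) ru(3)[OF P(2,1,3)] ru(3)[OF Q(2,1,3)]]
  show ?thesis
    unfolding d(2)[symmetric] by (intro integral_mono d(1) integrable_cost[OF \<kappa> P(3) Q(3)] u)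
qed

end

section \<open>The compensated cost\<close>

lemma set_integral_full_measure:
  fixes f :: "'a \<Rightarrow> real"
  assumes "AE x in M. x \<in> D" "D \<in> sets M" "f \<in> borel_measurable M"
  shows "(LINT x:D|M. f x) = (\<integral>x. f x \<partial>M)"
  unfolding set_lebesgue_integral_def
proof (rule integral_cong_AE)
  show "AE x in M. indicat_real D x *\<^sub>R f x = f x" using assms(1) by eventually_elim simp
qed (use assms in auto)

lemma l1_norm_bounds: "norm x \<le> l1_norm x" "l1_norm (x :: real ^ 'd) \<le> real CARD('d) * norm x"
proof -
  show "norm x \<le> l1_norm x" unfolding l1_norm_def by (rule norm_le_l1_cart)
  have "l1_norm x \<le> (\<Sum>i\<in>(UNIV :: 'd set). norm x)"
    unfolding l1_norm_def by (intro sum_mono component_le_norm_cart)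
  then show "l1_norm x \<le> real CARD('d) * norm x" by simp
qed

lemma integrable_norm_if_l1_norm:
  assumes "sets P = sets borel" "integrable P l1_norm"
  shows "integrable P (norm :: real ^ 'd \<Rightarrow> real)"
proof (rule Bochner_Integration.integrable_bound[OF assms(2)])
  show "(norm :: real ^ 'd \<Rightarrow> real) \<in> borel_measurable P" by (simp cong: measurable_cong_sets add: assms(1))
  have "norm x \<le> \<bar>l1_norm x\<bar>" for x :: "real ^ 'd" using l1_norm_bounds(1)[of x] by linarith
  then show "AE x in P. norm (norm (x :: real ^ 'd)) \<le> norm (l1_norm x)" by simp
qed

text \<open>Written with a nonnegative integral, the Lipschitz condition includes the integrability
  of the differences \<open>s \<theta> x - s \<theta> y\<close>.\<close>

locale score_family =
  fixes \<Lambda> :: "'t measure" and s :: "'t \<Rightarrow> real ^ 'd \<Rightarrow> real" and Lbar :: real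
  assumes s_measurable: "(\<lambda>(\<theta>, x). s \<theta> x) \<in> borel_measurable (\<Lambda> \<Otimes>\<^sub>M borel)"
    and s_zero: "integrable \<Lambda> (\<lambda>\<theta>. s \<theta> 0)"
    and s_lipschitz: "(\<integral>\<^sup>+\<theta>. ennreal \<bar>s \<theta> x - s \<theta> y\<bar> \<partial>\<Lambda>) \<le> ennreal (Lbar * l1_norm (x - y))"
begin

lemma integrable_score: "integrable \<Lambda> (\<lambda>\<theta>. s \<theta> x)"
proof -
  have m: "(\<lambda>\<theta>. s \<theta> x) \<in> borel_measurable \<Lambda>" for x
    using measurable_compose[OF measurable_Pair2'[of x borel \<Lambda>] s_measurable] by simp
  have "integrable \<Lambda> (\<lambda>\<theta>. s \<theta> x - s \<theta> 0)"
    using m le_less_trans[OF s_lipschitz[of x 0] ennreal_less_top] by (intro integrableI_bounded) auto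
  from Bochner_Integration.integrable_add[OF this s_zero] show ?thesis by simp
qed

lemma ell_nonneg: "0 \<le> ell \<Lambda> s x y"
  unfolding ell_def by (rule integral_nonneg_AE) simp

lemma ell_le: "ell \<Lambda> s x y \<le> \<bar>Lbar\<bar> * real CARD('d) * norm (x - y)"
proof -
  have i: "integrable \<Lambda> (\<lambda>\<theta>. \<bar>s \<theta> x - s \<theta> y\<bar>)" using integrable_score by simp
  have "ennreal (\<integral>\<theta>. \<bar>s \<theta> x - s \<theta> y\<bar> \<partial>\<Lambda>) \<le> ennreal (Lbar * l1_norm (x - y))"
    using s_lipschitz[of x y] nn_integral_eq_integral[OF i] by simp
  \<comment> \<open>The sign of \<open>Lbar\<close> is not prescribed and \<open>ennreal\<close>
    sends negative numbers to 0; with the absolute value the inequality can be read in the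
    reals.\<close>
  also have "\<dots> \<le> ennreal (\<bar>Lbar\<bar> * l1_norm (x - y))"
    by (intro ennreal_leI mult_right_mono) (auto simp: l1_norm_def sum_nonneg)
  finally have "(\<integral>\<theta>. \<bar>s \<theta> x - s \<theta> y\<bar> \<partial>\<Lambda>) \<le> \<bar>Lbar\<bar> * l1_norm (x - y)"
    by (subst (asm) ennreal_le_iff) (auto simp: l1_norm_def sum_nonneg)
  also have "\<dots> \<le> \<bar>Lbar\<bar> * (real CARD('d) * norm (x - y))"
    by (intro mult_left_mono l1_norm_bounds) simp
  finally have "(\<integral>\<theta>. \<bar>s \<theta> x - s \<theta> y\<bar> \<partial>\<Lambda>) \<le> \<bar>Lbar\<bar> * real CARD('d) * norm (x - y)" by (simp add: mult.assoc)
  moreover have "ell \<Lambda> s x y \<le> (\<integral>\<theta>. \<bar>s \<theta> x - s \<theta> y\<bar> \<partial>\<Lambda>)"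
    unfolding ell_def using integrable_score by (intro integral_mono) auto
  ultimately show ?thesis by simp
qed

text \<open>The positive part is subadditive, and this is integrated.\<close>

lemma ell_triangle: "ell \<Lambda> s x z \<le> ell \<Lambda> s x y + ell \<Lambda> s y z"
proof -
  have "ell \<Lambda> s x z \<le> (\<integral>\<theta>. max (s \<theta> x - s \<theta> y) 0 + max (s \<theta> y - s \<theta> z) 0 \<partial>\<Lambda>)"
    unfolding ell_def using integrable_score by (intro integral_mono) auto
  then show ?thesis unfolding ell_def using integrable_score by simp
qed

text \<open>A number is its positive part minus the positive part of its negative. Hence the
  antisymmetric part of \<open>ell\<close> is a difference of values of the mean score.\<close>

lemma ell_swap: "ell \<Lambda> s y x = ell \<Lambda> s x y - ((\<integral>\<theta>. s \<theta> x \<partial>\<Lambda>) - (\<integral>\<theta>. s \<theta> y \<partial>\<Lambda>))"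
proof -
  have "ell \<Lambda> s y x = (\<integral>\<theta>. max (s \<theta> x - s \<theta> y) 0 - (s \<theta> x - s \<theta> y) \<partial>\<Lambda>)"
    unfolding ell_def by (intro Bochner_Integration.integral_cong) auto
  then show ?thesis unfolding ell_def using integrable_score by simp
qed

text \<open>With \<open>m\<close> the mean score, \<open>ell_swap\<close> turns the cost into
  \<open>(1 - \<gamma>) * ell \<Lambda> s x y + \<gamma> * (m x - m y)\<close>. The first term
  satisfies the triangle inequality because \<gamma> is at most 1, and the second
  telescopes.\<close>

lemma lipschitz_cost_ell:
  assumes \<gamma>: "\<gamma> \<in> {0..1}"
  shows "lipschitz_cost (\<lambda>x y. ell \<Lambda> s x y - \<gamma> * ell \<Lambda> s y x) (\<bar>Lbar\<bar> * real CARD('d))"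
proof
  fix x y z :: "real ^ 'd"
  have "(1 - \<gamma>) * ell \<Lambda> s x z \<le> (1 - \<gamma>) * (ell \<Lambda> s x y + ell \<Lambda> s y z)"
    using \<gamma> by (intro mult_left_mono ell_triangle) auto
  then show "ell \<Lambda> s x z - \<gamma> * ell \<Lambda> s z x
      \<le> ell \<Lambda> s x y - \<gamma> * ell \<Lambda> s y x + (ell \<Lambda> s y z - \<gamma> * ell \<Lambda> s z y)"
    unfolding ell_swap[of z x] ell_swap[of y x] ell_swap[of z y] by (simp add: algebra_simps)
next
  fix x y :: "real ^ 'd"
  have "0 \<le> \<gamma> * ell \<Lambda> s y x" "\<gamma> * ell \<Lambda> s y x \<le> ell \<Lambda> s y x"
    using \<gamma> ell_nonneg[of y x] by (auto intro: mult_left_le_one_le)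
  then show "\<bar>ell \<Lambda> s x y - \<gamma> * ell \<Lambda> s y x\<bar> \<le> \<bar>Lbar\<bar> * real CARD('d) * norm (x - y)"
    using ell_nonneg[of x y] ell_le[of x y] ell_le[of y x] by (simp add: norm_minus_commute)
qed

end

section \<open>Duality for the compensated divergence and the dual form of the order\<close>

theorem theorem2p7:
  fixes D :: "(real ^ 'd) set"
    and P Q :: "(real ^ 'd) measure"
    and \<Lambda> :: "'t measure"
    and s :: "'t \<Rightarrow> real ^ 'd \<Rightarrow> real"
    and Lbar \<gamma> :: real
  assumes "D \<in> sets borel" and "D \<noteq> {}"
    and "prob_space P" and "sets P = sets borel" and "measure P D = 1"
    and "prob_space Q" and "sets Q = sets borel" and "measure Q D = 1"
    and "integrable P l1_norm" and "integrable Q l1_norm"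
    and "finite_measure \<Lambda>"
    and "(\<lambda>(\<theta>, x). s \<theta> x) \<in> borel_measurable (\<Lambda> \<Otimes>\<^sub>M borel)"
    and "\<forall>\<theta>\<in>space \<Lambda>. mono (s \<theta>)"
    and "integrable \<Lambda> (\<lambda>\<theta>. s \<theta> 0)"
    and "\<forall>x y. (\<integral>\<^sup>+\<theta>. ennreal \<bar>s \<theta> x - s \<theta> y\<bar> \<partial>\<Lambda>) \<le> ennreal (Lbar * l1_norm (x - y))"
    and "\<gamma> \<in> {0..1}"
  shows "csd_div \<Lambda> s \<gamma> D P Q =
           (SUP u\<in>csd_utilities \<Lambda> s \<gamma>. ereal ((LINT x:D|P. u x) - (LINT x:D|Q. u x)))
         \<and> (csd_le \<Lambda> s \<gamma> D P Q \<longleftrightarrow>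
           (\<forall>u\<in>csd_utilities \<Lambda> s \<gamma>. (LINT x:D|P. u x) \<le> (LINT x:D|Q. u x)))"
proof -
  interpret score_family \<Lambda> s Lbar
    using assms by unfold_locales auto
  interpret lipschitz_cost "\<lambda>x y. ell \<Lambda> s x y - \<gamma> * ell \<Lambda> s y x" "\<bar>Lbar\<bar> * real CARD('d)"
    by (rule lipschitz_cost_ell) fact
  \<comment> \<open>The case \<gamma> = 0 is \<open>ell\<close> itself; it gives the integrability
    of the separate terms in the definition of the order.\<close>
  interpret ell: lipschitz_cost "ell \<Lambda> s" "\<bar>Lbar\<bar> * real CARD('d)"
    using lipschitz_cost_ell[of 0] by simp
  have P: "prob_space P" "sets P = sets borel" "integrable P norm"
    and Q: "prob_space Q" "sets Q = sets borel" "integrable Q norm"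
    by (fact assms integrable_norm_if_l1_norm[OF assms(4,9)] integrable_norm_if_l1_norm[OF assms(7,10)])+
  have AE_P: "AE x in P. x \<in> D" and AE_Q: "AE x in Q. x \<in> D"
    using assms prob_space.AE_in_set_eq_1[OF P(1), of D] prob_space.AE_in_set_eq_1[OF Q(1), of D] by auto
  let ?c = "\<lambda>z. ell \<Lambda> s (fst z) (snd z) - \<gamma> * ell \<Lambda> s (snd z) (fst z)"
  have u_int: "(LINT x:D|P. u x) = (\<integral>x. u x \<partial>P)" "(LINT x:D|Q. u x) = (\<integral>x. u x \<partial>Q)"
    if "u \<in> csd_utilities \<Lambda> s \<gamma>" for u
  proof -
    have "u \<in> borel_measurable borel" using that by (intro potential_regular(2)) (auto simp: csd_utilities_def)
    then show "(LINT x:D|P. u x) = (\<integral>x. u x \<partial>P)" "(LINT x:D|Q. u x) = (\<integral>x. u x \<partial>Q)"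
      using AE_P AE_Q assms by (auto intro!: set_integral_full_measure cong: measurable_cong_sets)
  qed
  have full: "(LINT z:D \<times> D|\<kappa>. f z) = (\<integral>z. f z \<partial>\<kappa>)" if \<kappa>: "\<kappa> \<in> couplings P Q" and f: "f \<in> borel_measurable \<kappa>"
    for \<kappa> and f :: "_ \<Rightarrow> real"
  proof (rule set_integral_full_measure[OF _ _ f])
    note k = couplingsD[OF \<kappa>]
    have "AE z in \<kappa>. fst z \<in> D" "AE z in \<kappa>. snd z \<in> D"
      using AE_distrD[OF k(6), of "\<lambda>x. x \<in> D"] AE_distrD[OF k(7), of "\<lambda>x. x \<in> D"] AE_P AE_Q
      unfolding k(4,5) by blast+
    then show "AE z in \<kappa>. z \<in> D \<times> D" by eventually_elim (simp add: mem_Times_iff)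
    show "D \<times> D \<in> sets \<kappa>" using \<kappa> assms(1) by (simp add: couplings_def)
  qed
  have cost: "(LINT z:D \<times> D|\<kappa>. ?c z) = (\<integral>z. ?c z \<partial>\<kappa>)" if \<kappa>: "\<kappa> \<in> couplings P Q" for \<kappa>
    using integrable_cost[OF \<kappa> P(3) Q(3)] by (intro full[OF \<kappa>]) (rule borel_measurable_integrable)
  have weak: "(LINT x:D|P. u x) - (LINT x:D|Q. u x) \<le> (LINT z:D \<times> D|\<kappa>. ?c z)"
    if u: "u \<in> csd_utilities \<Lambda> s \<gamma>" and \<kappa>: "\<kappa> \<in> couplings P Q" for u \<kappa>
    unfolding u_int[OF u] cost[OF \<kappa>] using u by (intro weak_duality[OF P Q _ \<kappa>]) (auto simp: csd_utilities_def)
  \<comment> \<open>The bound \<open>V\<close> is left free: the supremum is inserted for the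
    duality and 0 for the order.\<close>
  have strong: "\<exists>\<kappa>\<in>couplings P Q. (LINT z:D \<times> D|\<kappa>. ?c z) \<le> V"
    if V: "\<And>u. u \<in> csd_utilities \<Lambda> s \<gamma> \<Longrightarrow> (LINT x:D|P. u x) - (LINT x:D|Q. u x) \<le> V" for V
  proof -
    have "(\<integral>x. u x \<partial>P) - (\<integral>x. u x \<partial>Q) \<le> V" if "\<And>x y. u x - u y \<le> ell \<Lambda> s x y - \<gamma> * ell \<Lambda> s y x" for u
    proof -
      have u: "u \<in> csd_utilities \<Lambda> s \<gamma>" using that by (simp add: csd_utilities_def)
      from V[OF u] show ?thesis unfolding u_int[OF u] .
    qed
    from optimal_coupling_duality[OF P Q this] show ?thesis using cost by auto
  qed
  have div: "csd_div \<Lambda> s \<gamma> D P Q =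
      (SUP u\<in>csd_utilities \<Lambda> s \<gamma>. ereal ((LINT x:D|P. u x) - (LINT x:D|Q. u x)))" (is "_ = ?S")
  proof (rule antisym)
    show "?S \<le> csd_div \<Lambda> s \<gamma> D P Q"
      unfolding csd_div_def using weak by (intro SUP_least INF_greatest) simp
    \<comment> \<open>By the triangle inequality the cost to the origin is a utility, so the
      supremum is not taken over an empty set and exceeds \<open>- \<infinity>\<close>.\<close>
    have "(\<lambda>x. ell \<Lambda> s x 0 - \<gamma> * ell \<Lambda> s 0 x) \<in> csd_utilities \<Lambda> s \<gamma>"
      using tri[where z = 0] by (simp add: csd_utilities_def algebra_simps)
    from SUP_upper[OF this, of "\<lambda>u. ereal ((LINT x:D|P. u x) - (LINT x:D|Q. u x))"]
    have "?S \<noteq> - \<infinity>" by auto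
    then show "csd_div \<Lambda> s \<gamma> D P Q \<le> ?S"
    proof (cases ?S)
      case (real V)
      have "(LINT x:D|P. u x) - (LINT x:D|Q. u x) \<le> V" if "u \<in> csd_utilities \<Lambda> s \<gamma>" for u
        using SUP_upper[OF that, of "\<lambda>u. ereal ((LINT x:D|P. u x) - (LINT x:D|Q. u x))"] real by simp
      from strong[OF this] obtain \<kappa> where "\<kappa> \<in> couplings P Q" "(LINT z:D \<times> D|\<kappa>. ?c z) \<le> V" by blast
      then show ?thesis unfolding csd_div_def real by (intro INF_lower2) auto
    qed auto
  qed
  have split: "(LINT z:D \<times> D|\<kappa>. ell \<Lambda> s (fst z) (snd z)) - \<gamma> * (LINT z:D \<times> D|\<kappa>. ell \<Lambda> s (snd z) (fst z))
      = (LINT z:D \<times> D|\<kappa>. ?c z)" if \<kappa>: "\<kappa> \<in> couplings P Q" for \<kappa>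
  proof -
    have i: "integrable \<kappa> (\<lambda>z. ell \<Lambda> s (fst z) (snd z))" by (rule ell.integrable_cost[OF \<kappa> P(3) Q(3)])
    \<comment> \<open>Exchanging the arguments preserves both conditions on the cost, so the second
      integral of the order is finite as well and the two may be combined.\<close>
    interpret flip: lipschitz_cost "\<lambda>x y. ell \<Lambda> s y x" "\<bar>Lbar\<bar> * real CARD('d)"
    proof
      show "ell \<Lambda> s z x \<le> ell \<Lambda> s y x + ell \<Lambda> s z y" for x y z using ell.tri[of z x y] by simp
      show "\<bar>ell \<Lambda> s y x\<bar> \<le> \<bar>Lbar\<bar> * real CARD('d) * norm (x - y)" for x y
        using ell.bound[of y x] by (simp add: norm_minus_commute)
    qed
    have j: "integrable \<kappa> (\<lambda>z. ell \<Lambda> s (snd z) (fst z))" by (rule flip.integrable_cost[OF \<kappa> P(3) Q(3)])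
    show ?thesis
      unfolding cost[OF \<kappa>] full[OF \<kappa> borel_measurable_integrable[OF i]] full[OF \<kappa> borel_measurable_integrable[OF j]]
      using i j by simp
  qed
  have "csd_le \<Lambda> s \<gamma> D P Q \<longleftrightarrow> (\<exists>\<kappa>\<in>couplings P Q. (LINT z:D \<times> D|\<kappa>. ?c z) \<le> 0)"
    unfolding csd_le_def by (intro bex_cong refl) (simp add: split[symmetric])
  \<comment> \<open>Attainment enters here: if all dual values are at most 0, some coupling itself
    has cost at most 0, not merely an infimum.\<close>
  also have "\<dots> \<longleftrightarrow> (\<forall>u\<in>csd_utilities \<Lambda> s \<gamma>. (LINT x:D|P. u x) \<le> (LINT x:D|Q. u x))"
    using weak strong[of 0] by fastforce
  finally show ?thesis using div by blast
qed

end
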